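(* Let $L(s)$ be a function defined by a Dirichlet series $\sum_{n\ge1}a_n n^{-s}$ for $\Re(s)>1$, which can be continued analytically to a meromorphic function on $\Re(s)>1/2$ having only finitely many poles, all of which lie on the line $\Re(s)=1$. Assume that $L(s)$ is of finite order and that for every fixed $\sigma$ with $1/2<\sigma<1$, $\int_0^T|L(\sigma+it)|^2\,dt\ll T$ as $T\to\infty$. Then for any polynomial $P_s\in\mathcal{D}_s[X]$ and any $\sigma_0>1/2$ we have $N_{P(L)}(\sigma_0,T)\ll T$, where $N_{P(L)}(\sigma_0,T)$ is the number of zeros $\rho$ of $P_s(L(s))$, counted with multiplicity, with $\Re(\rho)>\sigma_0$ and $0<\Im(\rho)<T$.
   Context: A general Dirichlet series is a series $\sum_{n=1}^\infty a_n e^{-\lambda_n s}$ with $a_n\in\mathbb{C}$, $\lambda_n\in\mathbb{R}$. $\mathcal{D}_s$ denotes the ring of all general Dirichlet series that are absolutely convergent in the half-plane $\Re(s)>1/2$, and $\mathcal{D}_s[X]$ the ring of polynomials in $X$ with coefficients in $\mathcal{D}_s$; for $P_s(X)=\sum_{k=0}^m c_k(s)X^k$ we write $P_s(L(s))=\sum_{k=0}^m c_k(s)L(s)^k$.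
   Formalization: The frequencies λ_n of a general Dirichlet series are required to tend to +∞ (for arbitrary real λ_n the claim fails, e.g. P constant equal to Σ e^{-n²}e^{ns}), and P_s(L(s)) is assumed not identically zero. *)

theory Defs
  imports "HOL-Complex_Analysis.Complex_Analysis" "HOL-Library.Landau_Symbols"
begin

text \<open>
  A general Dirichlet series has frequencies tending to infinity. They are not required to be
  increasing or distinct: in the presence of absolute convergence one may sort and merge them
  without changing the function, so this describes the same functions as the usual normalisation
  (frequencies strictly increasing to infinity). Values outside the half-plane are irrelevant.
\<close>

definition abs_conv_gen_dirichlet :: "real \<Rightarrow> (complex \<Rightarrow> complex) set" where
  "abs_conv_gen_dirichlet \<alpha> =
     {c. \<exists>(a :: nat \<Rightarrow> complex) (lam :: nat \<Rightarrow> real).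
           filterlim lam at_top sequentially \<and>
           (\<forall>s. Re s > \<alpha> \<longrightarrow>
              summable (\<lambda>n. norm (a n * exp (- (of_real (lam n) * s)))) \<and>
              c s = (\<Sum>n. a n * exp (- (of_real (lam n) * s))))}"

abbreviation D_s :: "(complex \<Rightarrow> complex) set" where
  "D_s \<equiv> abs_conv_gen_dirichlet (1/2)"

text \<open>
  The value at \<open>s\<close> of \<open>P\<^sub>s(L(s))\<close>, where \<open>P\<^sub>s\<close> has the coefficient functions \<open>c 0, \<dots>, c m\<close>.
\<close>

definition poly_comp ::
  "nat \<Rightarrow> (nat \<Rightarrow> complex \<Rightarrow> complex) \<Rightarrow> (complex \<Rightarrow> complex) \<Rightarrow> complex \<Rightarrow> complex" where
  "poly_comp m c L s = (\<Sum>k\<le>m. c k s * L s ^ k)"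

text \<open>
  Finite order in the sense of Dirichlet series (polynomial growth in vertical direction, uniformly
  in every closed half-plane to the right of \<open>\<alpha>\<close>), not in the sense of entire functions. The lower
  bound on \<open>\<bar>Im s\<bar>\<close> keeps away from the finitely many poles.
\<close>

definition finite_order_right_of :: "real \<Rightarrow> (complex \<Rightarrow> complex) \<Rightarrow> bool" where
  "finite_order_right_of \<alpha> L \<longleftrightarrow>
     (\<forall>\<sigma>\<^sub>1>\<alpha>. \<exists>A C t\<^sub>0. \<forall>s. Re s \<ge> \<sigma>\<^sub>1 \<and> \<bar>Im s\<bar> \<ge> t\<^sub>0 \<longrightarrow> norm (L s) \<le> C * \<bar>Im s\<bar> powr A)"

text \<open>
  Zeros of a meromorphic function, in terms of its behaviour near the point: the expression
  \<open>P\<^sub>s(L(s))\<close> may have a zero at a pole of \<open>L\<close>, when the coefficients vanish there.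
\<close>

definition zeros_in :: "(complex \<Rightarrow> complex) \<Rightarrow> real \<Rightarrow> real \<Rightarrow> complex set" where
  "zeros_in f \<sigma>\<^sub>0 T = {\<rho>. isolated_zero f \<rho> \<and> Re \<rho> > \<sigma>\<^sub>0 \<and> 0 < Im \<rho> \<and> Im \<rho> < T}"

definition zero_count :: "(complex \<Rightarrow> complex) \<Rightarrow> real \<Rightarrow> real \<Rightarrow> nat" where
  "zero_count f \<sigma>\<^sub>0 T = (\<Sum>\<rho>\<in>zeros_in f \<sigma>\<^sub>0 T. nat (zorder f \<rho>))"

end

theory Submission
  imports Defs "HOL-Real_Asymp.Real_Asymp"
begin

text \<open>
  Write \<open>F(s) = P\<^sub>s(L(s))\<close>. For large \<open>Re s\<close> it is an absolutely convergent general Dirichlet series, so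
  its leading term bounds it from below on a line \<open>Re s = b\<close>, uniformly in \<open>Im s\<close>. Jensen's inequality
  bounds the number of zeros in a disc of fixed radius around \<open>b + it\<close>, reaching beyond \<open>Re s = \<sigma>\<^sub>0\<close>
  to the left, by \<open>O(1 + sup \<bar>L\<bar>\<^sup>2)\<close>, the supremum being over a slightly larger disc. Cauchy's formula for
  \<open>L(z)\<^sup>2 exp((z - b - it)\<^sup>2)\<close> on the rectangle \<open>\<sigma>' \<le> Re z \<le> B\<close>, \<open>t/2 \<le> Im z \<le> 3t/2\<close> replaces this supremum
  by Gaussian averages of \<open>\<bar>L\<bar>\<^sup>2\<close> over two fixed vertical lines; finite order makes the horizontal
  sides negligible. Pointwise bounds are thus reduced to the mean square on a single line \<open>Re z = \<sigma>'\<close>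
  (on \<open>Re z = B\<close> the function \<open>L\<close> is bounded), and summing over equally spaced \<open>t\<close> up to \<open>T\<close> gives \<open>O(T)\<close>.
\<close>

section \<open>General Dirichlet series\<close>

text \<open>Passes to unordered sums, and expresses the growth of the frequencies by finiteness of
  their sublevel sets. Neither depends on an enumeration, so other index sets than
  \<open>nat\<close> become usable.\<close>

lemma abs_conv_gen_dirichletE:
  assumes "f \<in> abs_conv_gen_dirichlet \<alpha>"
  obtains lam :: "nat \<Rightarrow> real" and a :: "nat \<Rightarrow> complex" where
    "\<forall>x. finite {n. lam n \<le> x}"
    "\<forall>\<sigma>>\<alpha>. (\<lambda>n. norm (a n) * exp (- (lam n * \<sigma>))) summable_on UNIV"
    "\<forall>s. Re s > \<alpha> \<longrightarrow> ((\<lambda>n. a n * exp (- (of_real (lam n) * s))) has_sum f s) UNIV"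
proof -
  obtain a :: "nat \<Rightarrow> complex" and lam :: "nat \<Rightarrow> real" where
    lim: "filterlim lam at_top sequentially" and
    al: "\<forall>s. Re s > \<alpha> \<longrightarrow> summable (\<lambda>n. norm (a n * exp (- (of_real (lam n) * s)))) \<and>
      f s = (\<Sum>n. a n * exp (- (of_real (lam n) * s)))"
    using assms unfolding abs_conv_gen_dirichlet_def by (elim CollectE exE conjE)
  note sm = al[rule_format, THEN conjunct1] and eq = al[rule_format, THEN conjunct2]
  show ?thesis
  proof (rule that; intro allI impI)
    fix x
    have "eventually (\<lambda>n. lam n > x) sequentially"
      using lim unfolding filterlim_at_top_dense by blast
    then show "finite {n. lam n \<le> x}"
      unfolding cofinite_eq_sequentially[symmetric] eventually_cofinite by (simp add: not_less)
  next
    fix \<sigma> assume "\<sigma> > \<alpha>"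
    then have "summable (\<lambda>n. norm (a n) * exp (- (lam n * \<sigma>)))"
      using sm[of "of_real \<sigma>"] by (simp add: norm_mult)
    then show "(\<lambda>n. norm (a n) * exp (- (lam n * \<sigma>))) summable_on UNIV"
      by (subst summable_on_UNIV_nonneg_real_iff) simp_all
  next
    fix s assume s: "Re s > \<alpha>"
    have "summable (\<lambda>n. a n * exp (- (of_real (lam n) * s)))"
      using sm[OF s] by (rule summable_norm_cancel)
    then show "((\<lambda>n. a n * exp (- (of_real (lam n) * s))) has_sum f s) UNIV"
      using norm_summable_imp_has_sum[OF sm[OF s], of "f s"] eq[OF s] by (simp add: sums_iff)
  qed
qed

text \<open>The way back from an arbitrary countable index type: all conditions are invariant under
  reindexing, so any bijection \<open>g\<close> with \<open>nat\<close> yields a sequence of the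
  defining form.\<close>

lemma abs_conv_gen_dirichletI:
  fixes a :: "'i \<Rightarrow> complex" and lam :: "'i \<Rightarrow> real" and g :: "nat \<Rightarrow> 'i"
  assumes g: "bij g"
    and fin: "\<And>x. finite {i. lam i \<le> x}"
    and sm: "\<And>\<sigma>. \<sigma> > \<alpha> \<Longrightarrow> (\<lambda>i. norm (a i) * exp (- (lam i * \<sigma>))) summable_on UNIV"
    and hs: "\<And>s. Re s > \<alpha> \<Longrightarrow> ((\<lambda>i. a i * exp (- (of_real (lam i) * s))) has_sum f s) UNIV"
  shows "f \<in> abs_conv_gen_dirichlet \<alpha>"
proof -
  have "filterlim (\<lambda>n. lam (g n)) at_top sequentially"
    unfolding filterlim_at_top_dense
  proof
    fix x
    have "finite (g -` {i. lam i \<le> x})"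
      using g by (intro finite_vimageI fin) (auto simp: bij_def)
    then show "eventually (\<lambda>n. x < lam (g n)) sequentially"
      unfolding cofinite_eq_sequentially[symmetric] eventually_cofinite by (simp add: not_less vimage_def)
  qed
  moreover have "summable (\<lambda>n. norm (a (g n) * exp (- (of_real (lam (g n)) * s)))) \<and>
     f s = (\<Sum>n. a (g n) * exp (- (of_real (lam (g n)) * s)))" if s: "Re s > \<alpha>" for s
  proof
    have "(\<lambda>n. norm (a (g n)) * exp (- (lam (g n) * Re s))) summable_on UNIV"
      using sm[OF s] g
      by (simp add: summable_on_reindex_bij_betw[where f = "\<lambda>i. norm (a i) * exp (- (lam i * Re s))"])
    then show "summable (\<lambda>n. norm (a (g n) * exp (- (of_real (lam (g n)) * s))))"
      by (subst (asm) summable_on_UNIV_nonneg_real_iff) (simp_all add: norm_mult)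
    have "((\<lambda>n. a (g n) * exp (- (of_real (lam (g n)) * s))) has_sum f s) UNIV"
      using hs[OF s] g
      by (simp add: has_sum_reindex_bij_betw[where f = "\<lambda>i. a i * exp (- (of_real (lam i) * s))"])
    then show "f s = (\<Sum>n. a (g n) * exp (- (of_real (lam (g n)) * s)))"
      by (simp add: has_sum_imp_sums sums_unique)
  qed
  ultimately show ?thesis
    unfolding abs_conv_gen_dirichlet_def by (intro CollectI exI[of _ "a \<circ> g"] exI[of _ "lam \<circ> g"]) (auto simp: o_def)
qed

section \<open>Closure properties of general Dirichlet series\<close>

lemma abs_conv_gen_dirichlet_mono:
  "\<alpha> \<le> \<beta> \<Longrightarrow> abs_conv_gen_dirichlet \<alpha> \<subseteq> abs_conv_gen_dirichlet \<beta>"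
  unfolding abs_conv_gen_dirichlet_def by (safe, meson le_less_trans)

lemma abs_conv_gen_dirichlet_const: "(\<lambda>_. z) \<in> abs_conv_gen_dirichlet \<alpha>"
\<comment> \<open>Only the term of frequency 0 has a nonzero coefficient; the further frequencies
  serve to make the sequence tend to infinity.\<close>
proof (rule abs_conv_gen_dirichletI[where g = id and a = "\<lambda>n. if n = 0 then z else 0" and lam = real])
  show "finite {i. real i \<le> x}" for x
    by (rule finite_subset[of _ "{..nat \<lfloor>x\<rfloor>}"]) (auto simp: le_nat_iff le_floor_iff)
  show "((\<lambda>i. (if i = 0 then z else 0) * exp (- (of_real (real i) * s))) has_sum z) UNIV" for s
    by (rule has_sum_finite_neutralI[of "{0}"]) auto
  show "(\<lambda>i. norm (if i = 0 then z else 0) * exp (- (real i * \<sigma>))) summable_on UNIV" for \<sigma>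
    by (rule has_sum_imp_summable[OF has_sum_finite_neutralI[of "{0}"]]) auto
qed auto

text \<open>The two series are laid side by side over \<open>nat + nat\<close>; equal frequencies
  are allowed, so nothing has to be merged.\<close>

lemma abs_conv_gen_dirichlet_add:
  assumes "f \<in> abs_conv_gen_dirichlet \<alpha>" "h \<in> abs_conv_gen_dirichlet \<alpha>"
  shows "(\<lambda>s. f s + h s) \<in> abs_conv_gen_dirichlet \<alpha>"
proof -
  obtain lam a where f0: "\<forall>x. finite {n::nat. lam n \<le> x}"
    "\<forall>\<sigma>>\<alpha>. (\<lambda>n. norm (a n) * exp (- (lam n * \<sigma>))) summable_on UNIV"
    "\<forall>s. Re s > \<alpha> \<longrightarrow> ((\<lambda>n. a n * exp (- (of_real (lam n) * s))) has_sum f s) UNIV"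
    using assms(1) by (rule abs_conv_gen_dirichletE)
  note f = f0[rule_format]
  obtain \<mu> b where h0: "\<forall>x. finite {n::nat. \<mu> n \<le> x}"
    "\<forall>\<sigma>>\<alpha>. (\<lambda>n. norm (b n) * exp (- (\<mu> n * \<sigma>))) summable_on UNIV"
    "\<forall>s. Re s > \<alpha> \<longrightarrow> ((\<lambda>n. b n * exp (- (of_real (\<mu> n) * s))) has_sum h s) UNIV"
    using assms(2) by (rule abs_conv_gen_dirichletE)
  note h = h0[rule_format]
  have inl: "bij_betw Inl (UNIV :: nat set) (range (Inl :: nat \<Rightarrow> nat + nat))"
    and inr: "bij_betw Inr (UNIV :: nat set) (range (Inr :: nat \<Rightarrow> nat + nat))"
    by (auto simp: bij_betw_def)
  have disj: "range (Inl :: nat \<Rightarrow> nat + nat) \<inter> range Inr = {}" by auto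
  show ?thesis
  proof (rule abs_conv_gen_dirichletI[where g = sum_decode and a = "case_sum a b" and lam = "case_sum lam \<mu>"])
    fix x
    have "{i. case_sum lam \<mu> i \<le> x} = Inl ` {n. lam n \<le> x} \<union> Inr ` {n. \<mu> n \<le> x}"
      (is "?l = ?r")
    proof (intro set_eqI)
      show "i \<in> ?l \<longleftrightarrow> i \<in> ?r" for i by (cases i) auto
    qed
    then show "finite {i. case_sum lam \<mu> i \<le> x}" using f(1) h(1) by simp
  next
    fix \<sigma> assume s: "\<sigma> > \<alpha>"
    let ?F = "\<lambda>i. norm (case_sum a b i) * exp (- (case_sum lam \<mu> i * \<sigma>))"
    have "?F summable_on (range Inl \<union> range Inr)"
    proof (rule summable_on_Un_disjoint[OF _ _ disj])
      show "?F summable_on range Inl"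
        using f(2)[OF s] by (subst summable_on_reindex_bij_betw[OF inl, symmetric]) simp
      show "?F summable_on range Inr"
        using h(2)[OF s] by (subst summable_on_reindex_bij_betw[OF inr, symmetric]) simp
    qed
    then show "?F summable_on UNIV" by (simp add: UNIV_sum)
  next
    fix s assume s: "Re s > \<alpha>"
    let ?F = "\<lambda>i. case_sum a b i * exp (- (of_real (case_sum lam \<mu> i) * s))"
    have "(?F has_sum (f s + h s)) (range Inl \<union> range Inr)"
    proof (rule has_sum_Un_disjoint[OF _ _ disj])
      show "(?F has_sum f s) (range Inl)"
        using f(3)[OF s] by (subst has_sum_reindex_bij_betw[OF inl, symmetric]) simp
      show "(?F has_sum h s) (range Inr)"
        using h(3)[OF s] by (subst has_sum_reindex_bij_betw[OF inr, symmetric]) simp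
    qed
    then show "(?F has_sum (f s + h s)) UNIV" by (simp add: UNIV_sum)
  qed (rule bij_sum_decode)
qed

text \<open>The product is a series over pairs with frequencies \<open>lam i + \<mu> j\<close>. The
  double sum of moduli factorizes, which justifies iterated summation. Both frequency families are
  bounded below, so a bound on \<open>lam i + \<mu> j\<close> bounds each summand and leaves
  finitely many pairs.\<close>

lemma abs_conv_gen_dirichlet_mult:
  assumes "f \<in> abs_conv_gen_dirichlet \<alpha>" "h \<in> abs_conv_gen_dirichlet \<alpha>"
  shows "(\<lambda>s. f s * h s) \<in> abs_conv_gen_dirichlet \<alpha>"
proof -
  obtain lam a where f0: "\<forall>x. finite {n::nat. lam n \<le> x}"
    "\<forall>\<sigma>>\<alpha>. (\<lambda>n. norm (a n) * exp (- (lam n * \<sigma>))) summable_on UNIV"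
    "\<forall>s. Re s > \<alpha> \<longrightarrow> ((\<lambda>n. a n * exp (- (of_real (lam n) * s))) has_sum f s) UNIV"
    using assms(1) by (rule abs_conv_gen_dirichletE)
  note f = f0[rule_format]
  obtain \<mu> b where h0: "\<forall>x. finite {n::nat. \<mu> n \<le> x}"
    "\<forall>\<sigma>>\<alpha>. (\<lambda>n. norm (b n) * exp (- (\<mu> n * \<sigma>))) summable_on UNIV"
    "\<forall>s. Re s > \<alpha> \<longrightarrow> ((\<lambda>n. b n * exp (- (of_real (\<mu> n) * s))) has_sum h s) UNIV"
    using assms(2) by (rule abs_conv_gen_dirichletE)
  note h = h0[rule_format]
  have bdd: "\<exists>y. \<forall>n. y \<le> l n" if "\<And>x. finite {n::nat. l n \<le> x}" for l :: "nat \<Rightarrow> real"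
  proof -
    \<comment> \<open>Only finitely many frequencies are at most 0; the inserted 0 covers all others
      and the case that there are none.\<close>
    have "Min (insert 0 (l ` {n. l n \<le> 0})) \<le> l n" for n
    proof -
      have fin: "finite (insert 0 (l ` {n. l n \<le> 0}))" using that[of 0] by simp
      show ?thesis
      proof (cases "l n \<le> 0")
        case True
        then show ?thesis by (intro Min_le fin) auto
      next
        case False
        moreover have "Min (insert 0 (l ` {n. l n \<le> 0})) \<le> 0" by (intro Min_le fin) auto
        ultimately show ?thesis by linarith
      qed
    qed
    then show ?thesis by blast
  qed
  obtain y where y: "\<And>n. y \<le> lam n" using bdd f(1) by blast
  obtain y' where y': "\<And>n. y' \<le> \<mu> n" using bdd h(1) by blast
  have norm_sum: "(\<lambda>(i, j). norm (a i) * norm (b j) * exp (- ((lam i + \<mu> j) * \<sigma>))) summable_on UNIV"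
    if s: "\<sigma> > \<alpha>" for \<sigma>
  proof -
    let ?F = "\<lambda>(i, j). norm (a i) * norm (b j) * exp (- ((lam i + \<mu> j) * \<sigma>))"
    let ?A = "\<lambda>i. norm (a i) * exp (- (lam i * \<sigma>))" and ?B = "\<lambda>i. norm (b i) * exp (- (\<mu> i * \<sigma>))"
    have eq: "?F (i, j) = ?A i * ?B j" for i j
      by (simp add: algebra_simps flip: exp_add)
    have "?F summable_on (UNIV \<times> UNIV)"
    proof (rule summable_on_SigmaI)
      show "((\<lambda>j. ?F (i, j)) has_sum (?A i * infsum ?B UNIV)) UNIV" for i
        unfolding eq by (intro has_sum_cmult_right has_sum_infsum h(2) s)
      show "(\<lambda>i. ?A i * infsum ?B UNIV) summable_on UNIV"
        by (intro summable_on_cmult_left f(2) s)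
    qed auto
    then show ?thesis by simp
  qed
  show ?thesis
  proof (rule abs_conv_gen_dirichletI[where g = prod_decode and a = "\<lambda>(i, j). a i * b j"
        and lam = "\<lambda>(i, j). lam i + \<mu> j"])
    fix x
    have "{i. (case i of (i, j) \<Rightarrow> lam i + \<mu> j) \<le> x} \<subseteq> {n. lam n \<le> x - y'} \<times> {n. \<mu> n \<le> x - y}"
    proof safe
      fix i j assume "lam i + \<mu> j \<le> x"
      then show "lam i \<le> x - y'" "\<mu> j \<le> x - y" using y[of i] y'[of j] by auto
    qed
    then show "finite {i. (case i of (i, j) \<Rightarrow> lam i + \<mu> j) \<le> x}"
      by (rule finite_subset) (use f(1) h(1) in auto)
  next
    fix \<sigma> assume "\<sigma> > \<alpha>"
    from norm_sum[OF this]
    show "(\<lambda>i. norm (case i of (i, j) \<Rightarrow> a i * b j) * exp (- ((case i of (i, j) \<Rightarrow> lam i + \<mu> j) * \<sigma>))) summable_on UNIV"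
      by (simp add: case_prod_unfold norm_mult)
  next
    fix s assume s: "Re s > \<alpha>"
    let ?F = "\<lambda>i. (case i of (i, j) \<Rightarrow> a i * b j) * exp (- (of_real (case i of (i, j) \<Rightarrow> lam i + \<mu> j) * s))"
    have "?F summable_on UNIV"
      by (rule abs_summable_summable)
         (use norm_sum[OF s] in \<open>simp add: case_prod_unfold norm_mult\<close>)
    then have "(?F has_sum (f s * h s)) (UNIV \<times> UNIV)"
    proof (intro has_sum_SigmaI[where g = "\<lambda>i. a i * exp (- (of_real (lam i) * s)) * h s"])
      show "((\<lambda>j. ?F (i, j)) has_sum (a i * exp (- (of_real (lam i) * s)) * h s)) UNIV" for i
      proof -
        have "?F (i, j) = a i * exp (- (of_real (lam i) * s)) * (b j * exp (- (of_real (\<mu> j) * s)))" for j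
          by (simp add: algebra_simps flip: exp_add)
        then show ?thesis by (simp only:) (intro has_sum_cmult_right h(3) s)
      qed
      show "((\<lambda>i. a i * exp (- (of_real (lam i) * s)) * h s) has_sum (f s * h s)) UNIV"
        by (intro has_sum_cmult_left f(3) s)
    qed auto
    then show "(?F has_sum (f s * h s)) UNIV" by simp
  qed (rule bij_prod_decode)
qed

lemma abs_conv_gen_dirichlet_power:
  assumes "f \<in> abs_conv_gen_dirichlet \<alpha>"
  shows "(\<lambda>s. f s ^ k) \<in> abs_conv_gen_dirichlet \<alpha>"
  by (induction k) (auto intro: abs_conv_gen_dirichlet_const abs_conv_gen_dirichlet_mult assms)

lemma abs_conv_gen_dirichlet_sum:
  assumes "\<And>k. k \<in> A \<Longrightarrow> f k \<in> abs_conv_gen_dirichlet \<alpha>"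
  shows "(\<lambda>s. \<Sum>k\<in>A. f k s) \<in> abs_conv_gen_dirichlet \<alpha>"
  using assms
  by (induction A rule: infinite_finite_induct)
     (auto intro: abs_conv_gen_dirichlet_const abs_conv_gen_dirichlet_add)

text \<open>Convergence at a point \<open>\<beta>\<close> bounds the terms there; at
  \<open>s\<close> they are then dominated by a multiple of
  \<open>n powr - (Re s - \<beta>)\<close>, which is summable when the exponent is below -1. Hence
  the loss of 1 in the abscissa.\<close>

lemma sums_dirichlet_imp_abs_conv_gen_dirichlet:
  assumes "\<And>s. Re s > \<alpha> \<Longrightarrow> (\<lambda>n. a (Suc n) * of_nat (Suc n) powr (- s)) sums f s"
  shows "f \<in> abs_conv_gen_dirichlet (\<alpha> + 1)"
  unfolding abs_conv_gen_dirichlet_def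
proof (intro CollectI exI conjI allI impI)
  show "filterlim (\<lambda>n. ln (real (Suc n))) at_top sequentially"
    by (rule filterlim_compose[OF ln_at_top]) (rule filterlim_compose[OF filterlim_real_sequentially filterlim_Suc])
  fix s assume s: "Re s > \<alpha> + 1"
  have eq: "a (Suc n) * exp (- (of_real (ln (real (Suc n))) * s)) = a (Suc n) * of_nat (Suc n) powr (- s)" for n
    by (simp add: powr_def Ln_of_nat mult.commute del: of_nat_Suc)
  \<comment> \<open>The midpoint between \<open>\<alpha>\<close> and
    \<open>Re s - 1\<close>.\<close>
  define \<beta> where "\<beta> = (Re s + \<alpha> - 1) / 2"
  have \<beta>: "\<beta> > \<alpha>" "Re s - \<beta> > 1" using s by (auto simp: \<beta>_def field_simps)
  have "(\<lambda>n. a (Suc n) * of_nat (Suc n) powr (- of_real \<beta>)) \<longlonglongrightarrow> 0"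
    using assms[of "of_real \<beta>"] \<beta> by (intro summable_LIMSEQ_zero) (auto simp: sums_iff)
  then have "Bseq (\<lambda>n. a (Suc n) * of_nat (Suc n) powr (- of_real \<beta>))"
    by (intro convergent_imp_Bseq convergentI)
  then obtain K where K: "\<And>n. norm (a (Suc n) * of_nat (Suc n) powr (- of_real \<beta>)) \<le> K"
    by (auto simp: Bseq_def)
  have nrm: "norm (a (Suc n) * of_nat (Suc n) powr (- z)) = norm (a (Suc n)) * real (Suc n) powr (- Re z)" for n z
    by (simp add: norm_mult norm_powr_real_powr del: of_nat_Suc)
  have "summable (\<lambda>n. K * real (Suc n) powr - (Re s - \<beta>))"
    using \<beta> by (intro summable_mult) (subst summable_Suc_iff, simp add: summable_real_powr_iff)
  then show "summable (\<lambda>n. norm (a (Suc n) * exp (- (of_real (ln (real (Suc n))) * s))))"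
  proof (rule summable_comparison_test'[where N = 0])
    fix n
    have "norm (a (Suc n)) * real (Suc n) powr (- Re s) =
        norm (a (Suc n)) * real (Suc n) powr (- \<beta>) * real (Suc n) powr - (Re s - \<beta>)"
      by (simp flip: powr_add)
    also have "\<dots> \<le> K * real (Suc n) powr - (Re s - \<beta>)"
      using K[of n] unfolding nrm by (intro mult_right_mono) auto
    finally show "norm (norm (a (Suc n) * exp (- (of_real (ln (real (Suc n))) * s)))) \<le> K * real (Suc n) powr - (Re s - \<beta>)"
      unfolding eq real_norm_def abs_norm_cancel unfolding nrm .
  qed
  show "f s = (\<Sum>n. a (Suc n) * exp (- (of_real (ln (real (Suc n))) * s)))"
    unfolding eq using assms[of s] s by (simp add: sums_iff)
qed

section \<open>Tails, leading terms and bounds on strips\<close>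

lemma gen_dirichlet_tail_bound:
  fixes a :: "nat \<Rightarrow> complex" and lam :: "nat \<Rightarrow> real"
  assumes fin: "finite {n. lam n \<le> x}"
    and sm: "(\<lambda>n. norm (a n) * exp (- (lam n * \<sigma>))) summable_on UNIV"
    and hs: "((\<lambda>n. a n * exp (- (of_real (lam n) * s))) has_sum S) UNIV"
    and gap: "\<And>n. lam n > x \<Longrightarrow> lam n \<ge> y"
    and \<sigma>: "\<sigma> \<le> Re s"
  shows "norm (S - (\<Sum>n\<in>{n. lam n \<le> x}. a n * exp (- (of_real (lam n) * s))))
           \<le> exp (- (y * (Re s - \<sigma>))) * (\<Sum>\<^sub>\<infinity>n. norm (a n) * exp (- (lam n * \<sigma>)))"
proof (rule norm_infsum_le)
  let ?g = "\<lambda>n. a n * exp (- (of_real (lam n) * s))" and ?F = "{n. lam n \<le> x}"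
  have "(?g has_sum (S - sum ?g ?F)) (UNIV - ?F)"
    by (intro has_sum_Diff hs has_sum_finite fin) auto
  then show "((\<lambda>n. if n \<in> ?F then 0 else ?g n) has_sum (S - sum ?g ?F)) UNIV"
    by (rule has_sum_cong_neutral[THEN iffD1, rotated -1]) auto
  show "((\<lambda>n. exp (- (y * (Re s - \<sigma>))) * (norm (a n) * exp (- (lam n * \<sigma>)))) has_sum
      (exp (- (y * (Re s - \<sigma>))) * (\<Sum>\<^sub>\<infinity>n. norm (a n) * exp (- (lam n * \<sigma>))))) UNIV"
    by (intro has_sum_cmult_right has_sum_infsum sm)
  fix n
  show "norm (if n \<in> ?F then 0 else ?g n) \<le> exp (- (y * (Re s - \<sigma>))) * (norm (a n) * exp (- (lam n * \<sigma>)))"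
  proof (cases "n \<in> ?F")
    case False
    \<comment> \<open>A frequency in the tail is at least \<open>y\<close>, so moving from
      \<open>\<sigma>\<close> to \<open>Re s\<close> shrinks its term at least by
      \<open>exp (- (y * (Re s - \<sigma>)))\<close>.\<close>
    then have "y \<le> lam n" using gap by auto
    then have "y * (Re s - \<sigma>) \<le> lam n * (Re s - \<sigma>)" using \<sigma> by (intro mult_right_mono) auto
    then have "exp (- (lam n * Re s)) \<le> exp (- (y * (Re s - \<sigma>))) * exp (- (lam n * \<sigma>))"
      by (simp add: algebra_simps flip: exp_add)
    then have "norm (a n) * exp (- (lam n * Re s)) \<le> norm (a n) * (exp (- (y * (Re s - \<sigma>))) * exp (- (lam n * \<sigma>)))"
      by (rule mult_left_mono) simp
    then show ?thesis using False by (simp add: norm_mult mult.left_commute)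
  qed simp
qed

text \<open>The frequencies need not be distinct, so terms with equal frequency are first merged.\<close>

lemma gen_dirichlet_zero_or_lower_bound:
  assumes "f \<in> abs_conv_gen_dirichlet \<alpha>"
  shows "(\<forall>s. Re s > \<alpha> \<longrightarrow> f s = 0) \<or>
         (\<exists>K>0. \<exists>\<nu> \<sigma>\<^sub>1. \<forall>s. Re s \<ge> \<sigma>\<^sub>1 \<longrightarrow> norm (f s) \<ge> K * exp (- (\<nu> * Re s)))"
proof -
  obtain lam :: "nat \<Rightarrow> real" and a where f0: "\<forall>x. finite {n. lam n \<le> x}"
    "\<forall>\<sigma>>\<alpha>. (\<lambda>n. norm (a n) * exp (- (lam n * \<sigma>))) summable_on UNIV"
    "\<forall>s. Re s > \<alpha> \<longrightarrow> ((\<lambda>n. a n * exp (- (of_real (lam n) * s))) has_sum f s) UNIV"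
    using assms by (rule abs_conv_gen_dirichletE)
  note fin = f0(1)[rule_format] and sm = f0(2)[rule_format] and hs = f0(3)[rule_format]
  \<comment> \<open>The coefficient after merging; it is 0, as an empty sum, at a real number that
    is not a frequency.\<close>
  define A where "A x = (\<Sum>n | lam n = x. a n)" for x
  have partial: "(\<Sum>n\<in>{n. lam n \<le> x}. a n * exp (- (of_real (lam n) * s)))
      = (\<Sum>y\<in>lam ` {n. lam n \<le> x}. A y * exp (- (of_real y * s)))" (is "sum ?g ?F = _") for x s
  proof -
    have "sum ?g ?F = (\<Sum>y\<in>lam ` ?F. sum ?g {n \<in> ?F. lam n = y})"
      by (rule sum.image_gen[OF fin])
    also have "\<dots> = (\<Sum>y\<in>lam ` ?F. A y * exp (- (of_real y * s)))"
    proof (rule sum.cong[OF refl])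
      fix y assume "y \<in> lam ` ?F"
      then have "{n \<in> ?F. lam n = y} = {n. lam n = y}" by auto
      then show "sum ?g {n \<in> ?F. lam n = y} = A y * exp (- (of_real y * s))"
        by (simp add: A_def sum_distrib_right)
    qed
    finally show ?thesis .
  qed
  show ?thesis
  proof (cases "\<forall>x. A x = 0")
    case True
    have "f s = 0" if s: "Re s > \<alpha>" for s
    proof -
      \<comment> \<open>All merged coefficients vanish, so every partial sum does too, and the whole
        value is a tail beyond any \<open>x\<close>. At an abscissa strictly between
        \<open>\<alpha>\<close> and \<open>Re s\<close> the tail bound tends to 0 as
        \<open>x\<close> grows.\<close>
      define \<sigma> where "\<sigma> = (\<alpha> + Re s) / 2"
      have \<sigma>: "\<sigma> > \<alpha>" "Re s - \<sigma> > 0" using s by (auto simp: \<sigma>_def field_simps)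
      define K where "K = (\<Sum>\<^sub>\<infinity>n. norm (a n) * exp (- (lam n * \<sigma>)))"
      have bd: "norm (f s) \<le> exp (- (x * (Re s - \<sigma>))) * K" for x
        using gen_dirichlet_tail_bound[OF fin sm[OF \<sigma>(1)] hs[OF s], of x x] \<sigma>
        by (simp add: partial True K_def)
      have "((\<lambda>x. exp (- (x * (Re s - \<sigma>))) * K) \<longlongrightarrow> 0) at_top"
        using \<sigma>(2) by real_asymp
      then have "norm (f s) \<le> 0"
        by (rule tendsto_lowerbound) (simp_all add: bd)
      then show ?thesis by simp
    qed
    then show ?thesis by blast
  next
    case False
    then obtain x where x: "A x \<noteq> 0" by blast
    \<comment> \<open>Frequencies beyond \<open>x\<close> cannot be the smallest with nonzero
      coefficient; the cut at \<open>x\<close> makes the set finite, so that a minimum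
      exists.\<close>
    define Y where "Y = {y \<in> lam ` {n. lam n \<le> x}. A y \<noteq> 0}"
    have finY: "finite Y" using fin by (simp add: Y_def)
    have inY: "y \<in> Y" if "A y \<noteq> 0" "y \<le> x" for y
    proof -
      have "{n. lam n = y} \<noteq> {}"
      proof
        assume "{n. lam n = y} = {}"
        then have "A y = 0" unfolding A_def by (simp only: sum.empty)
        with that(1) show False by simp
      qed
      then show ?thesis using that by (auto simp: Y_def)
    qed
    define \<nu> where "\<nu> = Min Y"
    have "Y \<noteq> {}" using inY[OF x] by auto
    then have \<nu>Y: "\<nu> \<in> Y" unfolding \<nu>_def by (intro Min_in finY)
    have A\<nu>: "A \<nu> \<noteq> 0" and \<nu>x: "\<nu> \<le> x" using \<nu>Y by (auto simp: Y_def)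
    have A0: "A y = 0" if "y < \<nu>" for y
    proof (rule ccontr)
      assume "A y \<noteq> 0"
      then have "\<nu> \<le> y" unfolding \<nu>_def by (intro Min_le finY inY) (use that \<nu>x in auto)
      then show False using that by simp
    qed
    \<comment> \<open>The next frequency above \<open>\<nu>\<close>, capped at
      \<open>\<nu> + 1\<close>; the cap leaves finitely many candidates, so the gap
      \<open>y - \<nu>\<close> is positive.\<close>
    define y where "y = Min (insert (\<nu> + 1) (lam ` {n. \<nu> < lam n \<and> lam n \<le> \<nu> + 1}))"
    have fin1: "finite (insert (\<nu> + 1) (lam ` {n. \<nu> < lam n \<and> lam n \<le> \<nu> + 1}))"
      using finite_subset[OF _ fin[of "\<nu> + 1"]] by auto
    have y\<nu>: "y > \<nu>" unfolding y_def using fin1 by (subst Min_gr_iff) auto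
    have gap: "lam n \<ge> y" if "lam n > \<nu>" for n
    proof (cases "lam n \<le> \<nu> + 1")
      case True
      then show ?thesis unfolding y_def using that by (intro Min_le fin1) auto
    next
      case False
      moreover have "y \<le> \<nu> + 1" unfolding y_def by (intro Min_le fin1) auto
      ultimately show ?thesis by linarith
    qed
    have lead: "(\<Sum>n\<in>{n. lam n \<le> \<nu>}. a n * exp (- (of_real (lam n) * s))) = A \<nu> * exp (- (of_real \<nu> * s))" for s
    proof -
      have "(\<Sum>y\<in>lam ` {n. lam n \<le> \<nu>}. A y * exp (- (of_real y * s)))
          = (\<Sum>y\<in>{\<nu>}. A y * exp (- (of_real y * s)))"
      proof (intro sum.mono_neutral_right finite_imageI fin ballI)
        show "{\<nu>} \<subseteq> lam ` {n. lam n \<le> \<nu>}" using \<nu>Y by (auto simp: Y_def)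
        fix y assume "y \<in> lam ` {n. lam n \<le> \<nu>} - {\<nu>}"
        then have "A y = 0" by (intro A0) auto
        then show "A y * exp (- (of_real y * s)) = 0" by simp
      qed
      then show ?thesis by (simp add: partial)
    qed
    define \<sigma> where "\<sigma> = \<alpha> + 1"
    define K where "K = (\<Sum>\<^sub>\<infinity>n. norm (a n) * exp (- (lam n * \<sigma>)))"
    \<comment> \<open>The tail bound divided by \<open>exp (- (\<nu> * u))\<close>: relative to the
      leading term the tail decays because of the gap, and it finally drops below half the leading
      coefficient.\<close>
    have "((\<lambda>u. exp (- ((y - \<nu>) * u)) * (exp (y * \<sigma>) * K)) \<longlongrightarrow> 0) at_top"
      using y\<nu> by real_asymp
    then have "eventually (\<lambda>u. exp (- ((y - \<nu>) * u)) * (exp (y * \<sigma>) * K) < norm (A \<nu>) / 2) at_top"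
      by (rule order_tendstoD) (use A\<nu> in auto)
    then obtain u0 where u0: "\<And>u. u \<ge> u0 \<Longrightarrow> exp (- ((y - \<nu>) * u)) * (exp (y * \<sigma>) * K) < norm (A \<nu>) / 2"
      by (auto simp: eventually_at_top_linorder)
    have "norm (A \<nu>) / 2 * exp (- (\<nu> * Re s)) \<le> norm (f s)" if s: "Re s \<ge> max u0 \<sigma>" for s
    proof -
      have s': "Re s > \<alpha>" "\<sigma> > \<alpha>" "\<sigma> \<le> Re s" using s by (auto simp: \<sigma>_def)
      have "norm (f s - A \<nu> * exp (- (of_real \<nu> * s))) \<le> exp (- (y * (Re s - \<sigma>))) * K"
        using gen_dirichlet_tail_bound[where x = \<nu>, OF fin sm[OF s'(2)] hs[OF s'(1)] gap s'(3)] by (simp add: lead K_def)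
      also have "exp (- (y * (Re s - \<sigma>))) * K = exp (- ((y - \<nu>) * Re s)) * (exp (y * \<sigma>) * K) * exp (- (\<nu> * Re s))"
        by (simp add: algebra_simps flip: exp_add)
      also have "\<dots> \<le> norm (A \<nu>) / 2 * exp (- (\<nu> * Re s))"
        using u0[of "Re s"] s by (intro mult_right_mono) auto
      finally have 1: "norm (f s - A \<nu> * exp (- (of_real \<nu> * s))) \<le> norm (A \<nu>) / 2 * exp (- (\<nu> * Re s))" .
      have "norm (A \<nu> * exp (- (of_real \<nu> * s))) = norm (A \<nu>) * exp (- (\<nu> * Re s))"
        by (simp add: norm_mult)
      then show ?thesis
        using 1 norm_triangle_ineq2[of "A \<nu> * exp (- (of_real \<nu> * s))" "f s"]
        by (simp add: norm_minus_commute)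
    qed
    moreover have "norm (A \<nu>) / 2 > 0" using A\<nu> by simp
    ultimately show ?thesis by blast
  qed
qed

text \<open>Each \<open>exp (- (lam n * x))\<close> is monotone in \<open>x\<close>, in a direction
  given by the sign of \<open>lam n\<close>; adding the values at both ends of the strip covers
  either case.\<close>

lemma gen_dirichlet_strip_dominated:
  assumes sm: "\<And>\<sigma>. \<sigma> > \<alpha> \<Longrightarrow> (\<lambda>n. norm (a n) * exp (- (lam n * \<sigma>))) summable_on (UNIV :: nat set)"
    and "\<alpha> < \<sigma>\<^sub>1" "\<sigma>\<^sub>1 \<le> \<sigma>\<^sub>2"
  defines "M \<equiv> \<lambda>n. norm (a n) * exp (- (lam n * \<sigma>\<^sub>1)) + norm (a n) * exp (- (lam n * \<sigma>\<^sub>2))"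
  shows "M summable_on UNIV"
    and "\<And>n s. \<sigma>\<^sub>1 \<le> Re s \<Longrightarrow> Re s \<le> \<sigma>\<^sub>2 \<Longrightarrow> norm ((a n :: complex) * exp (- (of_real (lam n) * s))) \<le> M n"
proof -
  show "M summable_on UNIV"
    unfolding M_def using assms(2,3) by (intro summable_on_add sm) auto
  fix n s assume s: "\<sigma>\<^sub>1 \<le> Re s" "Re s \<le> \<sigma>\<^sub>2"
  have "exp (- (lam n * Re s)) \<le> exp (- (lam n * \<sigma>\<^sub>1)) + exp (- (lam n * \<sigma>\<^sub>2))"
  proof (cases "lam n \<ge> 0")
    case True
    then have "exp (- (lam n * Re s)) \<le> exp (- (lam n * \<sigma>\<^sub>1))" using s by (simp add: mult_left_mono)
    then show ?thesis by (smt (verit) exp_gt_zero)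
  next
    case False
    then have "exp (- (lam n * Re s)) \<le> exp (- (lam n * \<sigma>\<^sub>2))" using s by (simp add: mult_left_mono_neg)
    then show ?thesis by (smt (verit) exp_gt_zero)
  qed
  then show "norm (a n * exp (- (of_real (lam n) * s))) \<le> M n"
    unfolding M_def distrib_left[symmetric] by (simp add: norm_mult mult_left_mono)
qed

text \<open>The strip is bounded on the right because negative frequencies may let the series grow
  there.\<close>

lemma abs_conv_gen_dirichlet_bounded_strip:
  assumes "f \<in> abs_conv_gen_dirichlet \<alpha>" "\<alpha> < \<sigma>\<^sub>1"
  shows "\<exists>K. \<forall>s. \<sigma>\<^sub>1 \<le> Re s \<and> Re s \<le> \<sigma>\<^sub>2 \<longrightarrow> norm (f s) \<le> K"
proof (cases "\<sigma>\<^sub>1 \<le> \<sigma>\<^sub>2")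
  case True
  obtain lam :: "nat \<Rightarrow> real" and a where f0: "\<forall>x. finite {n. lam n \<le> x}"
    "\<forall>\<sigma>>\<alpha>. (\<lambda>n. norm (a n) * exp (- (lam n * \<sigma>))) summable_on UNIV"
    "\<forall>s. Re s > \<alpha> \<longrightarrow> ((\<lambda>n. a n * exp (- (of_real (lam n) * s))) has_sum f s) UNIV"
    using assms(1) by (rule abs_conv_gen_dirichletE)
  note dom = gen_dirichlet_strip_dominated[OF f0(2)[rule_format] assms(2) True]
  show ?thesis
    by (rule exI, intro allI impI, rule norm_infsum_le[OF f0(3)[rule_format] has_sum_infsum[OF dom(1)] dom(2)])
       (use assms(2) in auto)
next
  case False
  then show ?thesis by auto
qed

text \<open>The strip majorant feeds the Weierstrass test on small closed discs, so the finite
  partial sums converge uniformly there.\<close>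

lemma abs_conv_gen_dirichlet_holomorphic:
  assumes "f \<in> abs_conv_gen_dirichlet \<alpha>"
  shows "f holomorphic_on {s. Re s > \<alpha>}"
proof -
  obtain lam :: "nat \<Rightarrow> real" and a where f0: "\<forall>x. finite {n. lam n \<le> x}"
    "\<forall>\<sigma>>\<alpha>. (\<lambda>n. norm (a n) * exp (- (lam n * \<sigma>))) summable_on UNIV"
    "\<forall>s. Re s > \<alpha> \<longrightarrow> ((\<lambda>n. a n * exp (- (of_real (lam n) * s))) has_sum f s) UNIV"
    using assms by (rule abs_conv_gen_dirichletE)
  show ?thesis
    unfolding holomorphic_on_open[OF open_halfspace_Re_gt]
  proof
    fix s assume s: "s \<in> {s. Re s > \<alpha>}"
    define \<delta> where "\<delta> = (Re s - \<alpha>) / 2"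
    have \<delta>: "\<delta> > 0" "\<alpha> < Re s - \<delta>" "Re s - \<delta> \<le> Re s + \<delta>" using s by (auto simp: \<delta>_def field_simps)
    note dom = gen_dirichlet_strip_dominated[OF f0(2)[rule_format] \<delta>(2,3)]
    have strip: "Re s - \<delta> \<le> Re z \<and> Re z \<le> Re s + \<delta>" if "z \<in> cball s \<delta>" for z
      using that abs_Re_le_cmod[of "s - z"] by (auto simp: dist_norm)
    have "uniform_limit (cball s \<delta>) (\<lambda>X z. \<Sum>n\<in>X. a n * exp (- (of_real (lam n) * z))) f (finite_subsets_at_top UNIV)"
    proof (rule Weierstrass_m_test_general')
      fix n z assume "z \<in> cball s \<delta>"
      then show "norm (a n * exp (- (of_real (lam n) * z))) \<le>
        norm (a n) * exp (- (lam n * (Re s - \<delta>))) + norm (a n) * exp (- (lam n * (Re s + \<delta>)))"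
        using strip by (intro dom(2)) auto
    next
      fix z assume "z \<in> cball s \<delta>"
      then show "((\<lambda>n. a n * exp (- (of_real (lam n) * z))) has_sum f z) UNIV"
        using strip \<delta> by (intro f0(3)[rule_format]) force
    qed (rule dom(1))
    then have "f holomorphic_on ball s \<delta>"
      by (rule holomorphic_uniform_limit[rotated])
         (auto intro!: always_eventually continuous_intros holomorphic_intros)
    then show "\<exists>f'. (f has_field_derivative f') (at s)"
      using \<delta>(1) by (auto simp: holomorphic_on_open)
  qed
qed

section \<open>Zeros in discs\<close>

text \<open>The points are divided out one after another. The point \<open>z0\<close> excludes
  \<open>f = 0\<close>, so all orders are finite; at a point of \<open>Z\<close> with
  \<open>f \<rho> \<noteq> 0\<close> the order is 0 and the factor is 1.\<close>

lemma holomorphic_factor_out_zeros: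
  assumes holf: "f holomorphic_on U" and U: "open U" "connected U"
    and z0: "z0 \<in> U" "f z0 \<noteq> 0" and "finite Z" "Z \<subseteq> U"
  shows "\<exists>g. g holomorphic_on U \<and> (\<forall>z\<in>U. f z = (\<Prod>\<rho>\<in>Z. (z - \<rho>) ^ nat (zorder f \<rho>)) * g z)"
  using \<open>finite Z\<close> \<open>Z \<subseteq> U\<close>
proof (induction Z rule: finite_induct)
  case empty
  then show ?case using holf by auto
next
  case (insert \<rho> Z)
  define n where "n = nat (zorder f \<rho>)"
  define P where "P z = (\<Prod>\<rho>\<in>Z. (z - \<rho>) ^ nat (zorder f \<rho>))" for z
  obtain g where g: "g holomorphic_on U" "\<And>z. z \<in> U \<Longrightarrow> f z = P z * g z"
    using insert unfolding P_def by auto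
  have \<rho>: "\<rho> \<in> U" using insert by auto
  have Prho: "P \<rho> \<noteq> 0" using insert by (auto simp: P_def)
  have holP: "P holomorphic_on A" for A unfolding P_def by (intro holomorphic_intros)
  obtain r where r: "r > 0" "cball \<rho> r \<subseteq> U" "zor_poly f \<rho> holomorphic_on cball \<rho> r"
      "\<And>w. w \<in> cball \<rho> r \<Longrightarrow> f w = zor_poly f \<rho> w * (w - \<rho>) ^ n"
    using zorder_exist_zero[OF holf U \<rho>] z0 unfolding n_def by blast
  let ?h = "\<lambda>z. zor_poly f \<rho> z / P z"
  \<comment> \<open>The quotient has a removable singularity at \<open>\<rho>\<close>. Near
    \<open>\<rho>\<close> it agrees with \<open>zor_poly f \<rho> z / P z\<close>, which is
    holomorphic there because \<open>\<rho>\<close> is not in \<open>Z\<close> and so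
    \<open>P \<rho> \<noteq> 0\<close>.\<close>
  define G where "G z = (if z = \<rho> then ?h \<rho> else g z / (z - \<rho>) ^ n)" for z
  have near: "eventually (\<lambda>z. z \<in> ball \<rho> r \<and> P z \<noteq> 0) (nhds \<rho>)"
    using r(1) holomorphic_on_imp_continuous_on[OF holP[of UNIV]] Prho
    by (intro eventually_conj eventually_nhds_in_open)
       (auto simp: continuous_on_eq_continuous_at isCont_def intro!: tendsto_imp_eventually_ne
         simp flip: tendsto_at_iff_tendsto_nhds)
  then obtain S where S: "open S" "\<rho> \<in> S" "\<And>z. z \<in> S \<Longrightarrow> z \<in> ball \<rho> r \<and> P z \<noteq> 0"
    unfolding eventually_nhds by blast
  have "G holomorphic_on (U - {\<rho>}) \<union> S"
  proof (rule holomorphic_on_Un)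
    have "(\<lambda>z. g z / (z - \<rho>) ^ n) holomorphic_on (U - {\<rho>})"
      by (intro holomorphic_intros holomorphic_on_subset[OF g(1)]) auto
    then show "G holomorphic_on U - {\<rho>}"
      by (rule holomorphic_transform) (auto simp: G_def)
    have "?h holomorphic_on S"
      using S(3) by (intro holomorphic_intros holP holomorphic_on_subset[OF r(3)]) (force dest: S(3))+
    then show "G holomorphic_on S"
    proof (rule holomorphic_transform)
      fix z assume z: "z \<in> S"
      then have "z \<in> cball \<rho> r" "P z \<noteq> 0" using S(3)[OF z] by auto
      moreover from this have "P z * g z = zor_poly f \<rho> z * (z - \<rho>) ^ n"
        using g(2)[of z] r(2) r(4)[of z] by auto
      ultimately show "?h z = G z" by (auto simp: G_def field_simps)
    qed
  qed (use U S in auto)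
  then have holG: "G holomorphic_on U" by (rule holomorphic_on_subset) (use S in auto)
  have "f z = (\<Prod>\<rho>\<in>insert \<rho> Z. (z - \<rho>) ^ nat (zorder f \<rho>)) * G z" if z: "z \<in> U" for z
  proof -
    have *: "(\<Prod>\<rho>\<in>insert \<rho> Z. (z - \<rho>) ^ nat (zorder f \<rho>)) = (z - \<rho>) ^ n * P z"
      using insert by (simp add: n_def P_def)
    show ?thesis
    proof (cases "z = \<rho>")
      case True
      then show ?thesis unfolding * using r(1) r(4)[of \<rho>] Prho by (simp add: G_def)
    next
      case False
      then show ?thesis unfolding * using g(2)[OF z] by (simp add: G_def)
    qed
  qed
  with holG show ?case by blast
qed

text \<open>Dividing out the zeros by Blaschke factors of the disc does not change the modulus on the
  circle.\<close>

lemma jensen_zero_bound: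
  assumes holf: "f holomorphic_on U" and U: "open U" "connected U" "cball c R \<subseteq> U"
    and r: "0 < r" "r < R" and fc: "f c \<noteq> 0"
    and M: "\<And>z. dist c z = R \<Longrightarrow> norm (f z) \<le> M"
    and Z: "finite Z" "Z \<subseteq> cball c r"
  shows "norm (f c) * (R / r) ^ (\<Sum>\<rho>\<in>Z. nat (zorder f \<rho>)) \<le> M"
proof -
  define n where "n \<rho> = nat (zorder f \<rho>)" for \<rho>
  have c: "c \<in> U" using U r by auto
  have ZU: "Z \<subseteq> U" using Z U(3) r by (meson cball_subset_cball_iff less_imp_le order_trans subset_cball)
  obtain g where g: "g holomorphic_on U" "\<And>z. z \<in> U \<Longrightarrow> f z = (\<Prod>\<rho>\<in>Z. (z - \<rho>) ^ n \<rho>) * g z"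
    using holomorphic_factor_out_zeros[OF holf U(1,2) c fc Z(1) ZU] unfolding n_def by blast
  \<comment> \<open>\<open>B \<rho>\<close> replaces the factor \<open>z - \<rho>\<close>: on the
    circle it has the same modulus, while at the centre it equals \<open>R\<close> instead of having
    modulus at most \<open>r\<close>. Each zero thus gains a factor \<open>R / r\<close>.\<close>
  define B where "B \<rho> z = (of_real (R\<^sup>2) - cnj (\<rho> - c) * (z - c)) / of_real R" for \<rho> z :: complex
  define H where "H z = (\<Prod>\<rho>\<in>Z. B \<rho> z ^ n \<rho>) * g z" for z
  have B: "norm (B \<rho> z) = norm (z - \<rho>)" if "dist c z = R" for \<rho> z
  proof -
    have "complex_of_real (R\<^sup>2) = (z - c) * cnj (z - c)"
      using that unfolding complex_norm_square[symmetric] by (simp add: dist_norm norm_minus_commute)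
    then have "B \<rho> z = (z - c) * cnj (z - \<rho>) / of_real R"
      by (simp add: B_def algebra_simps)
    then show ?thesis
      using that r by (simp add: norm_mult norm_divide dist_norm norm_minus_commute del: complex_cnj_diff)
  qed
  have "norm (H c) \<le> M"
  proof (rule maximum_modulus_frontier[where S = "cball c R" and f = H])
    have "H holomorphic_on U" unfolding H_def B_def by (intro holomorphic_intros g) (use r in auto)
    then have holH: "H holomorphic_on cball c R" using U(3) holomorphic_on_subset by blast
    then show "H holomorphic_on interior (cball c R)" using holomorphic_on_subset interior_subset by blast
    show "continuous_on (closure (cball c R)) H" using holH holomorphic_on_imp_continuous_on by simp
    fix z assume "z \<in> frontier (cball c R)"
    then have z: "dist c z = R" by simp
    then have "norm (H z) = norm (f z)" using g(2)[of z] U(3)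
      by (auto simp: H_def norm_mult norm_power B simp flip: prod_norm)
    then show "norm (H z) \<le> M" using M[OF z] by simp
  qed (use r in auto)
  moreover have "norm (f c) * (R / r) ^ (\<Sum>\<rho>\<in>Z. n \<rho>) \<le> norm (H c)"
  proof -
    have Hc: "norm (H c) = R ^ (\<Sum>\<rho>\<in>Z. n \<rho>) * norm (g c)"
      using r by (simp add: H_def B_def norm_mult norm_power power2_eq_square power_sum flip: prod_norm)
    have "norm (f c) = (\<Prod>\<rho>\<in>Z. norm (c - \<rho>) ^ n \<rho>) * norm (g c)"
      by (simp add: g(2)[OF c] norm_mult norm_power flip: prod_norm)
    also have "\<dots> \<le> (\<Prod>\<rho>\<in>Z. r ^ n \<rho>) * norm (g c)"
      using Z by (intro mult_right_mono prod_mono conjI power_mono) (auto simp: dist_norm)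
    finally have "norm (f c) \<le> r ^ (\<Sum>\<rho>\<in>Z. n \<rho>) * norm (g c)" by (simp add: power_sum)
    then have "norm (f c) * (R / r) ^ (\<Sum>\<rho>\<in>Z. n \<rho>) \<le> r ^ (\<Sum>\<rho>\<in>Z. n \<rho>) * norm (g c) * (R / r) ^ (\<Sum>\<rho>\<in>Z. n \<rho>)"
      using r by (intro mult_right_mono) auto
    also have "\<dots> = norm (H c)" using r by (simp add: Hc power_divide)
    finally show ?thesis .
  qed
  ultimately show ?thesis unfolding n_def by linarith
qed

text \<open>Near any point of \<open>K\<close> a meromorphic function either vanishes on a punctured
  neighbourhood, which then contains no isolated zero, or has no zero on one. So isolated zeros do
  not accumulate in the compact set.\<close>

lemma finite_isolated_zeros_meromorphic:
  assumes mero: "f meromorphic_on A" and K: "compact K" "K \<subseteq> A"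
  shows "finite {z \<in> K. isolated_zero f z}"
proof -
  have "\<not> z islimpt {z \<in> K. isolated_zero f z}" if z: "z \<in> K" for z
  proof -
    have sing: "isolated_singularity_at f z" "not_essential f z"
      using mero z K(2) unfolding meromorphic_on_altdef by auto
    have ana: "eventually (\<lambda>w. f analytic_on {w}) (at z)"
      using sing(1) by (rule isolated_singularity_at_altdef[THEN iffD1])
    have "eventually (\<lambda>w. \<not> isolated_zero f w) (at z)"
    proof (cases "\<exists>\<^sub>F w in at z. f w = 0")
      case True
      then have "eventually (\<lambda>w. f w = 0) (at z)"
        using sing not_essential_frequently_0_imp_eventually_0 by blast
      then obtain S where S: "open S" "z \<in> S" "\<And>w. w \<in> S \<Longrightarrow> w \<noteq> z \<Longrightarrow> f w = 0"
        unfolding eventually_at_topological by blast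
      have "\<not> isolated_zero f w" if w: "w \<in> S - {z}" for w
      proof
        assume "isolated_zero f w"
        then have "eventually (\<lambda>x. f x \<noteq> 0) (at w)" by (simp add: isolated_zero_def)
        moreover have "eventually (\<lambda>x. x \<in> S - {z}) (at w)"
          using w S(1) by (intro eventually_at_in_open') auto
        ultimately have "eventually (\<lambda>x. False) (at w)"
          by eventually_elim (use S(3) in auto)
        then show False by simp
      qed
      then show ?thesis unfolding eventually_at_topological using S(1,2) by blast
    next
      case False
      then have "eventually (\<lambda>w. f w \<noteq> 0) (at z)" by (simp add: frequently_def)
      with ana show ?thesis by eventually_elim (use zero_isolated_zero_analytic in blast)
    qed
    then show ?thesis
      unfolding islimpt_iff_eventually by (auto elim: eventually_mono)
  qed
  then have "finite (K \<inter> {z \<in> K. isolated_zero f z})"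
    using finite_not_islimpt_in_compact[OF K(1)] by blast
  then show ?thesis by (simp add: Int_def Collect_conj_eq[symmetric] conj_ac)
qed

section \<open>Gaussian means on vertical lines\<close>

text \<open>Cauchy's formula with kernel at most \<open>1 / d\<close>, as \<open>s\<close> has
  distance at least \<open>d\<close> from all sides. The vertical sides are kept as integrals, which
  can later be averaged; the horizontal ones are only estimated by their maximum.\<close>

lemma cauchy_rectangle_bound:
  assumes holg: "g holomorphic_on S" and S: "convex S" "open S"
    and sub: "cbox (Complex x1 y1) (Complex x2 y2) \<subseteq> S"
    and d: "d > 0" "Re s - x1 \<ge> d" "x2 - Re s \<ge> d" "Im s - y1 \<ge> d" "y2 - Im s \<ge> d"
    and M: "\<And>x. x1 \<le> x \<Longrightarrow> x \<le> x2 \<Longrightarrow> norm (g (Complex x y1)) \<le> M"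
           "\<And>x. x1 \<le> x \<Longrightarrow> x \<le> x2 \<Longrightarrow> norm (g (Complex x y2)) \<le> M"
  shows "2 * pi * d * norm (g s) \<le>
     integral {y1..y2} (\<lambda>y. norm (g (Complex x1 y)) + norm (g (Complex x2 y))) + 2 * (x2 - x1) * M"
proof -
  define h where "h z = g z / (z - s)" for z
  define p1 p2 p3 p4 where "p1 = Complex x1 y1" and "p2 = Complex x2 y1"
    and "p3 = Complex x2 y2" and "p4 = Complex x1 y2"
  note p = p1_def p2_def p3_def p4_def
  have lt: "x1 < x2" "y1 < y2" using d by linarith+
  have inbox: "s \<in> box p1 p3" using d by (auto simp: p in_box_complex_iff)
  have bnd: "z \<in> S \<and> norm (z - s) \<ge> d" if "z \<in> path_image (rectpath p1 p3)" for z
  proof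
    show "z \<in> S" using that path_image_rectpath_subset_cbox[of p1 p3] sub lt by (auto simp: p)
    have "d \<le> \<bar>Re (z - s)\<bar> \<or> d \<le> \<bar>Im (z - s)\<bar>"
      using that lt d by (auto simp: path_image_rectpath p)
    then show "norm (z - s) \<ge> d"
      using abs_Re_le_cmod[of "z - s"] abs_Im_le_cmod[of "z - s"] by linarith
  qed
  have rp: "rectpath p1 p3 = linepath p1 p2 +++ linepath p2 p3 +++ linepath p3 p4 +++ linepath p4 p1"
    by (simp add: rectpath_def Let_def p)
  have seg: "closed_segment p1 p2 \<subseteq> path_image (rectpath p1 p3)" "closed_segment p2 p3 \<subseteq> path_image (rectpath p1 p3)"
    "closed_segment p3 p4 \<subseteq> path_image (rectpath p1 p3)" "closed_segment p4 p1 \<subseteq> path_image (rectpath p1 p3)"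
    unfolding rp by (auto simp: path_image_join)
  have conth: "continuous_on A h" if "A \<subseteq> path_image (rectpath p1 p3)" for A
    unfolding h_def using that bnd d(1)
    by (intro continuous_intros continuous_on_subset[OF holomorphic_on_imp_continuous_on[OF holg]]) fastforce+
  have int: "h contour_integrable_on linepath p1 p2" "h contour_integrable_on linepath p2 p3"
    "h contour_integrable_on linepath p3 p4" "h contour_integrable_on linepath p4 p1"
    by (intro contour_integrable_continuous_linepath conth seg)+
  have "(h has_contour_integral (2 * pi * \<i> * winding_number (rectpath p1 p3) s * g s)) (rectpath p1 p3)"
    unfolding h_def
  proof (rule Cauchy_integral_formula_convex_simple[OF S(1) holg])
    have "s \<in> S" using inbox box_subset_cbox[of p1 p3] sub by (auto simp: p)
    then show "s \<in> interior S" using S(2) by (simp add: interior_open)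
    show "path_image (rectpath p1 p3) \<subseteq> S - {s}" using bnd d(1) by fastforce
  qed auto
  then have "contour_integral (rectpath p1 p3) h = 2 * pi * \<i> * g s"
    by (simp add: winding_number_rectpath[OF inbox] contour_integral_unique)
  moreover have "contour_integral (rectpath p1 p3) h = contour_integral (linepath p1 p2) h
     + (contour_integral (linepath p2 p3) h + (contour_integral (linepath p3 p4) h + contour_integral (linepath p4 p1) h))"
    unfolding rp by (simp add: int valid_path_join)
  ultimately have eq: "2 * pi * \<i> * g s = contour_integral (linepath p1 p2) h
     + (contour_integral (linepath p2 p3) h + (contour_integral (linepath p3 p4) h + contour_integral (linepath p4 p1) h))"
    by simp
  have M0: "M \<ge> 0" using M(1)[of x1] lt norm_ge_zero order_trans by (meson less_imp_le order_refl)
  have hle: "norm (h z) \<le> norm (g z) / d" if "z \<in> path_image (rectpath p1 p3)" for z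
    using bnd[OF that] d(1) unfolding h_def norm_divide by (intro divide_left_mono mult_pos_pos) auto
  have horiz: "norm (contour_integral (linepath q q') h) \<le> M / d * (x2 - x1)"
    if q: "closed_segment q q' \<subseteq> path_image (rectpath p1 p3)" "norm (q' - q) = x2 - x1"
      "\<And>z. z \<in> closed_segment q q' \<Longrightarrow> norm (g z) \<le> M" for q q'
    unfolding q(2)[symmetric]
  proof (rule contour_integral_bound_linepath)
    show "h contour_integrable_on linepath q q'"
      by (intro contour_integrable_continuous_linepath conth q)
    show "0 \<le> M / d" using M0 d by simp
    fix z assume z: "z \<in> closed_segment q q'"
    then have "norm (h z) \<le> norm (g z) / d" using hle q(1) by blast
    also have "\<dots> \<le> M / d" using q(3)[OF z] d by (simp add: divide_right_mono)
    finally show "norm (h z) \<le> M / d" .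
  qed
  have contg: "continuous_on {y1..y2} (\<lambda>y. norm (g (Complex x y)))" if "x \<in> {x1, x2}" for x
  proof (rule continuous_on_norm, rule continuous_on_compose2[OF holomorphic_on_imp_continuous_on[OF holg]])
    show "continuous_on {y1..y2} (Complex x)" unfolding Complex_eq by (intro continuous_intros)
    show "Complex x ` {y1..y2} \<subseteq> S" using that lt sub by (auto simp: in_cbox_complex_iff)
  qed
  have vert: "norm (contour_integral (linepath (Complex x y1) (Complex x y2)) h)
      \<le> integral {y1..y2} (\<lambda>y. norm (g (Complex x y))) / d" if x: "x \<in> {x1, x2}" for x
  proof -
    have mem: "Complex x y \<in> path_image (rectpath p1 p3)" if "y \<in> {y1..y2}" for y
      using that x lt by (auto simp: path_image_rectpath p)
    have "norm (contour_integral (linepath (Complex x y1) (Complex x y2)) h)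
        = norm (integral {y1..y2} (\<lambda>y. h (Complex x y)))"
      using lt by (subst contour_integral_linepath_same_Re[where c = x and a = y1 and b = y2]) (auto simp: norm_mult)
    also have "\<dots> \<le> integral {y1..y2} (\<lambda>y. norm (g (Complex x y)) / d)"
    proof (rule integral_norm_bound_integral)
      show "(\<lambda>y. h (Complex x y)) integrable_on {y1..y2}"
      proof (rule integrable_continuous_real, rule continuous_on_compose2[OF conth[OF order_refl]])
        show "continuous_on {y1..y2} (Complex x)" unfolding Complex_eq by (intro continuous_intros)
      qed (use mem in auto)
      show "(\<lambda>y. norm (g (Complex x y)) / d) integrable_on {y1..y2}"
        by (intro integrable_continuous_real continuous_intros contg x) (use d in auto)
    qed (use hle mem in auto)
    finally show ?thesis by simp
  qed
  \<comment> \<open>The contour runs down the left side, whereas \<open>vert\<close> integrates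
    upwards.\<close>
  have "norm (contour_integral (linepath p4 p1) h) = norm (contour_integral (linepath p1 p4) h)"
    using contour_integral_reverse_linepath[of p4 p1 h] conth[OF seg(4)] by simp
  then have v: "norm (contour_integral (linepath p4 p1) h) \<le> integral {y1..y2} (\<lambda>y. norm (g (Complex x1 y))) / d"
    "norm (contour_integral (linepath p2 p3) h) \<le> integral {y1..y2} (\<lambda>y. norm (g (Complex x2 y))) / d"
    using vert[of x1] vert[of x2] by (auto simp: p)
  have h: "norm (contour_integral (linepath p1 p2) h) \<le> M / d * (x2 - x1)"
    "norm (contour_integral (linepath p3 p4) h) \<le> M / d * (x2 - x1)"
  proof -
    show "norm (contour_integral (linepath p1 p2) h) \<le> M / d * (x2 - x1)"
    proof (rule horiz[OF seg(1)])
      show "norm (p2 - p1) = x2 - x1" using lt by (simp add: p cmod_def)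
      fix z assume "z \<in> closed_segment p1 p2"
      then have "x1 \<le> Re z" "Re z \<le> x2" "z = Complex (Re z) y1"
        using lt by (auto simp: p closed_segment_same_Im closed_segment_eq_real_ivl complex_eq_iff)
      then show "norm (g z) \<le> M" using M(1) by metis
    qed
    show "norm (contour_integral (linepath p3 p4) h) \<le> M / d * (x2 - x1)"
    proof (rule horiz[OF seg(3)])
      show "norm (p4 - p3) = x2 - x1" using lt by (simp add: p cmod_def)
      fix z assume "z \<in> closed_segment p3 p4"
      then have "x1 \<le> Re z" "Re z \<le> x2" "z = Complex (Re z) y2"
        using lt by (auto simp: p closed_segment_same_Im closed_segment_eq_real_ivl complex_eq_iff)
      then show "norm (g z) \<le> M" using M(2) by metis
    qed
  qed
  have "2 * pi * norm (g s) = norm (2 * pi * \<i> * g s)" by (simp add: norm_mult)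
  also have "\<dots> \<le> norm (contour_integral (linepath p1 p2) h) + (norm (contour_integral (linepath p2 p3) h)
     + (norm (contour_integral (linepath p3 p4) h) + norm (contour_integral (linepath p4 p1) h)))"
    unfolding eq by (intro order_trans[OF norm_triangle_ineq] add_left_mono order_refl)
  also have "\<dots> \<le> M / d * (x2 - x1) + (integral {y1..y2} (\<lambda>y. norm (g (Complex x2 y))) / d
     + (M / d * (x2 - x1) + integral {y1..y2} (\<lambda>y. norm (g (Complex x1 y))) / d))"
    by (intro add_mono v h)
  also have "\<dots> = (integral {y1..y2} (\<lambda>y. norm (g (Complex x1 y)) + norm (g (Complex x2 y))) + 2 * (x2 - x1) * M) / d"
    by (subst integral_add) (use d(1) in \<open>auto intro!: integrable_continuous_real contg simp: field_simps\<close>)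
  finally show ?thesis using d(1) by (simp add: field_simps)
qed

text \<open>Comparison with differences of \<open>arctan\<close> makes sums of Gaussians over an arithmetic progression
  telescope.\<close>

lemma exp_minus_square_le_arctan_diff:
  fixes x \<eta> :: real
  assumes \<eta>: "\<eta> > 0"
  shows "exp (- x\<^sup>2) \<le> 2 * (1 + \<eta>\<^sup>2) / \<eta> * (arctan (x + \<eta>) - arctan x)"
proof -
  obtain \<xi> where \<xi>: "x < \<xi>" "\<xi> < x + \<eta>" "arctan (x + \<eta>) - arctan x = (x + \<eta> - x) * inverse (1 + \<xi>\<^sup>2)"
    using MVT2[of x "x + \<eta>" arctan "\<lambda>x. inverse (1 + x\<^sup>2)"] \<eta> by (auto intro: DERIV_arctan)
  have pos: "1 + \<xi>\<^sup>2 > 0" by (simp add: add_pos_nonneg)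
  \<comment> \<open>The mean value point lies within \<open>\<eta>\<close> of \<open>x\<close>, so
    passing from \<open>\<xi>\<close> to \<open>x\<close> costs at most the factor
    \<open>2 * (1 + \<eta>\<^sup>2)\<close>; then
    \<open>1 + x\<^sup>2 \<le> exp (x\<^sup>2)\<close>.\<close>
  have "(\<xi> - x)\<^sup>2 \<le> \<eta>\<^sup>2" using \<xi> by (intro power_mono) auto
  moreover have "\<xi>\<^sup>2 \<le> 2 * x\<^sup>2 + 2 * (\<xi> - x)\<^sup>2"
    using zero_le_power2[of "2 * x - \<xi>"] by (simp add: power2_eq_square algebra_simps)
  moreover have "0 \<le> \<eta>\<^sup>2 * x\<^sup>2" by simp
  moreover have "2 * (1 + \<eta>\<^sup>2) * (1 + x\<^sup>2) = 2 + 2 * x\<^sup>2 + 2 * \<eta>\<^sup>2 + 2 * (\<eta>\<^sup>2 * x\<^sup>2)" by (simp add: algebra_simps)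
  ultimately have "1 + \<xi>\<^sup>2 \<le> 2 * (1 + \<eta>\<^sup>2) * (1 + x\<^sup>2)" by linarith
  also have "\<dots> \<le> 2 * (1 + \<eta>\<^sup>2) * exp (x\<^sup>2)" by (intro mult_left_mono exp_ge_add_one_self) auto
  finally have "exp (- x\<^sup>2) * (1 + \<xi>\<^sup>2) \<le> exp (- x\<^sup>2) * (2 * (1 + \<eta>\<^sup>2) * exp (x\<^sup>2))"
    by (intro mult_left_mono) auto
  also have "\<dots> = 2 * (1 + \<eta>\<^sup>2)" by (simp add: exp_minus)
  finally have "exp (- x\<^sup>2) \<le> 2 * (1 + \<eta>\<^sup>2) / (1 + \<xi>\<^sup>2)" using pos by (simp add: field_simps)
  also have "\<dots> = 2 * (1 + \<eta>\<^sup>2) / \<eta> * (arctan (x + \<eta>) - arctan x)"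
    unfolding \<xi>(3) using \<eta> by (simp add: divide_inverse mult_ac)
  finally show ?thesis .
qed

text \<open>The bound is uniform in \<open>N\<close> and \<open>y\<close>, since
  \<open>arctan\<close> has total variation \<open>pi\<close>.\<close>

lemma sum_gaussian_le:
  fixes \<eta> y :: real
  assumes \<eta>: "\<eta> > 0"
  shows "(\<Sum>n<N. exp (- (y - real n * \<eta>)\<^sup>2)) \<le> 2 * pi * (1 + \<eta>\<^sup>2) / \<eta>"
proof -
  have "(\<Sum>n<N. exp (- (y - real n * \<eta>)\<^sup>2))
      \<le> (\<Sum>n<N. 2 * (1 + \<eta>\<^sup>2) / \<eta> * (arctan (real (Suc n) * \<eta> - y) - arctan (real n * \<eta> - y)))"
  proof (rule sum_mono)
    fix n
    show "exp (- (y - real n * \<eta>)\<^sup>2) \<le> 2 * (1 + \<eta>\<^sup>2) / \<eta> * (arctan (real (Suc n) * \<eta> - y) - arctan (real n * \<eta> - y))"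
      using exp_minus_square_le_arctan_diff[OF \<eta>, of "real n * \<eta> - y"]
      by (simp add: algebra_simps power2_commute[of y])
  qed
  also have "\<dots> = 2 * (1 + \<eta>\<^sup>2) / \<eta> * (arctan (real N * \<eta> - y) - arctan (- y))"
    by (simp only: sum_distrib_left[symmetric] sum_lessThan_telescope[where f = "\<lambda>n. arctan (real n * \<eta> - y)"]) simp
  also have "\<dots> \<le> 2 * (1 + \<eta>\<^sup>2) / \<eta> * pi"
    using arctan_ubound[of "real N * \<eta> - y"] arctan_lbound[of "- y"] \<eta> by (intro mult_left_mono) auto
  finally show ?thesis by (simp add: algebra_simps)
qed

text \<open>All windows are enlarged to one interval of length \<open>O(N)\<close>. After exchanging
  sum and integral the Gaussians add up to at most a constant at each \<open>y\<close>, and the mean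
  value of \<open>\<phi>\<close> remains.\<close>

lemma sum_gaussian_integrals_linear:
  fixes \<phi> :: "real \<Rightarrow> real"
  assumes cont: "continuous_on {0..} \<phi>" and nonneg: "\<And>y. y \<ge> 0 \<Longrightarrow> \<phi> y \<ge> 0" and \<eta>: "\<eta> > 0"
    and mean: "(\<lambda>T. integral {0..T} \<phi>) \<in> O[at_top](\<lambda>T. T)"
  shows "\<exists>E. \<forall>N. (\<Sum>n<N. integral {real n * \<eta> / 2..3 * (real n * \<eta>) / 2} (\<lambda>y. \<phi> y * exp (- (y - real n * \<eta>)\<^sup>2)))
           \<le> E * (real N + 1)"
proof -
  obtain D where D: "D > 0" "eventually (\<lambda>T. norm (integral {0..T} \<phi>) \<le> D * norm T) at_top"
    using mean by (elim landau_o.bigE)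
  then obtain T0 where T0: "\<And>T. T \<ge> T0 \<Longrightarrow> norm (integral {0..T} \<phi>) \<le> D * norm T"
    unfolding eventually_at_top_linorder by blast
  define C where "C = 2 * pi * (1 + \<eta>\<^sup>2) / \<eta>"
  have C: "C > 0" using \<eta> by (auto simp: C_def intro!: divide_pos_pos mult_pos_pos add_pos_nonneg)
  \<comment> \<open>Long enough to contain every window and to reach the range in which the mean
    value bound holds.\<close>
  define Y where "Y N = 2 * (real N * \<eta>) + \<bar>T0\<bar>" for N :: nat
  have Y: "Y N \<ge> 0" "Y N \<ge> T0" for N using \<eta> by (auto simp: Y_def intro: add_increasing)
  have int: "f integrable_on {u..v}" if "continuous_on {0..} f" "u \<ge> 0" for f :: "real \<Rightarrow> real" and u v
    using that by (intro integrable_continuous_real) (rule continuous_on_subset, auto)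
  have cw: "continuous_on {0..} (\<lambda>y. \<phi> y * exp (- (y - u)\<^sup>2))" for u :: real
    by (intro continuous_intros cont)
  show ?thesis
  proof (intro exI allI)
    fix N
    have "(\<Sum>n<N. integral {real n * \<eta> / 2..3 * (real n * \<eta>) / 2} (\<lambda>y. \<phi> y * exp (- (y - real n * \<eta>)\<^sup>2)))
       \<le> (\<Sum>n<N. integral {0..Y N} (\<lambda>y. \<phi> y * exp (- (y - real n * \<eta>)\<^sup>2)))"
    proof (rule sum_mono, rule integral_subset_le)
      fix n assume "n \<in> {..<N}"
      then have "real n * \<eta> \<le> real N * \<eta>" using \<eta> by (intro mult_right_mono) auto
      moreover have "0 \<le> real n * \<eta>" using \<eta> by simp
      ultimately show "{real n * \<eta> / 2..3 * (real n * \<eta>) / 2} \<subseteq> {0..Y N}"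
        unfolding Y_def by auto
    qed (use \<eta> in \<open>auto intro!: int cw nonneg mult_nonneg_nonneg\<close>)
    also have "\<dots> = integral {0..Y N} (\<lambda>y. \<Sum>n<N. \<phi> y * exp (- (y - real n * \<eta>)\<^sup>2))"
      by (rule integral_sum[symmetric]) (auto intro!: int cw)
    also have "\<dots> \<le> integral {0..Y N} (\<lambda>y. C * \<phi> y)"
    proof (rule integral_le)
      fix y assume y: "y \<in> {0..Y N}"
      have "(\<Sum>n<N. \<phi> y * exp (- (y - real n * \<eta>)\<^sup>2)) = \<phi> y * (\<Sum>n<N. exp (- (y - real n * \<eta>)\<^sup>2))"
        by (simp add: sum_distrib_left)
      also have "\<dots> \<le> \<phi> y * C"
        unfolding C_def using y nonneg by (intro mult_left_mono sum_gaussian_le \<eta>) auto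
      finally show "(\<Sum>n<N. \<phi> y * exp (- (y - real n * \<eta>)\<^sup>2)) \<le> C * \<phi> y" by (simp add: mult.commute)
    qed (auto intro!: int continuous_intros cont)
    also have "\<dots> = C * integral {0..Y N} \<phi>" by simp
    also have "\<dots> \<le> C * (D * Y N)"
      using T0[OF Y(2)[of N]] Y(1)[of N] C by (intro mult_left_mono) auto
    also have "\<dots> \<le> C * (D * ((2 * \<eta> + \<bar>T0\<bar>) * (real N + 1)))"
      using C D \<eta> by (intro mult_left_mono) (auto simp: Y_def algebra_simps)
    finally show "(\<Sum>n<N. integral {real n * \<eta> / 2..3 * (real n * \<eta>) / 2} (\<lambda>y. \<phi> y * exp (- (y - real n * \<eta>)\<^sup>2)))
        \<le> C * D * (2 * \<eta> + \<bar>T0\<bar>) * (real N + 1)" by (simp add: mult.assoc)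
  qed
qed

lemma norm_exp_square_Complex: "norm (exp ((Complex x y - Complex b t)\<^sup>2)) = exp ((x - b)\<^sup>2 - (y - t)\<^sup>2)"
  by (simp add: power2_eq_square)

lemma powr_times_gaussian_tendsto_0:
  fixes u :: real
  assumes "u > 0"
  shows "((\<lambda>t. (C * (t * u) powr A)\<^sup>2 * exp (w - t\<^sup>2 / 4)) \<longlongrightarrow> 0) at_top"
proof -
  \<comment> \<open>The exponent is halved because the whole expression is squared
    afterwards.\<close>
  have "((\<lambda>t. (t * u) powr A * exp (- (t\<^sup>2 / 8))) \<longlongrightarrow> 0) at_top"
    using assms by real_asymp
  then have "((\<lambda>t. C\<^sup>2 * exp w * ((t * u) powr A * exp (- (t\<^sup>2 / 8)))\<^sup>2) \<longlongrightarrow> C\<^sup>2 * exp w * 0\<^sup>2) at_top"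
    by (intro tendsto_intros)
  moreover have "C\<^sup>2 * exp w * ((t * u) powr A * exp (- (t\<^sup>2 / 8)))\<^sup>2 = (C * (t * u) powr A)\<^sup>2 * exp (w - t\<^sup>2 / 4)" for t
  proof -
    have "(exp (- (t\<^sup>2 / 8)))\<^sup>2 * exp w = exp (w - t\<^sup>2 / 4)"
      unfolding power2_eq_square[of "exp _"] exp_add[symmetric] by simp
    then show ?thesis by (simp add: power_mult_distrib mult_ac)
  qed
  ultimately show ?thesis by simp
qed

text \<open>The Gaussian factor makes the horizontal sides of the rectangle negligible against the polynomial
  growth of \<open>L\<close>, so the mean square of \<open>L\<close> on two vertical lines controls \<open>L\<close> in between.\<close>

lemma local_square_bound:
  fixes L :: "complex \<Rightarrow> complex"
  assumes holL: "L holomorphic_on {s. Re s > \<alpha> \<and> Im s > \<tau>}"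
    and \<sigma>: "\<alpha> < \<sigma>'" "\<sigma>' < \<sigma>''" "\<sigma>'' < b" "\<sigma>'' - \<sigma>' \<le> 1"
    and growth: "\<And>s. Re s \<ge> \<sigma>' \<Longrightarrow> \<bar>Im s\<bar> \<ge> t0 \<Longrightarrow> norm (L s) \<le> C * \<bar>Im s\<bar> powr A"
  defines "R \<equiv> b - \<sigma>''"
  defines "\<phi> \<equiv> \<lambda>y. (norm (L (Complex \<sigma>' y)))\<^sup>2 + (norm (L (Complex (b + R + 1) y)))\<^sup>2"
  shows "\<exists>K>0. \<exists>t1>0. \<forall>t\<ge>t1. t / 2 > \<tau> \<and> t - R > \<tau> \<and> (\<forall>s\<in>cball (Complex b t) R.
     (norm (L s))\<^sup>2 \<le> K * (1 + integral {t / 2..3 * t / 2} (\<lambda>y. \<phi> y * exp (- (y - t)\<^sup>2))))"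
proof -
  \<comment> \<open>The right side of the rectangle is 1 away from the disc, the left side
    \<open>\<delta> \<le> 1\<close>; so \<open>\<delta>\<close> serves as the distance in Cauchy's
    estimate. \<open>W\<close> bounds the distance of the rectangle's abscissae from
    \<open>b\<close>.\<close>
  define B where "B = b + R + 1"
  define W where "W = B - \<sigma>'"
  define \<delta> where "\<delta> = \<sigma>'' - \<sigma>'"
  have pos: "R > 0" "\<delta> > 0" "W > 0" "\<sigma>' < b" "\<sigma>' < B" "b < B" using \<sigma> by (auto simp: R_def B_def W_def \<delta>_def)
  have "((\<lambda>t. (C * (t / 2) powr A)\<^sup>2 * exp (W\<^sup>2 - t\<^sup>2 / 4)) \<longlongrightarrow> 0) at_top"
    using powr_times_gaussian_tendsto_0[of "1 / 2" C A "W\<^sup>2"] by simp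
  moreover have "((\<lambda>t. (C * (3 * t / 2) powr A)\<^sup>2 * exp (W\<^sup>2 - t\<^sup>2 / 4)) \<longlongrightarrow> 0) at_top"
    using powr_times_gaussian_tendsto_0[of "3 / 2" C A "W\<^sup>2"] by (simp add: mult.commute)
  ultimately have "eventually (\<lambda>t. (C * (t / 2) powr A)\<^sup>2 * exp (W\<^sup>2 - t\<^sup>2 / 4) < 1 \<and>
      (C * (3 * t / 2) powr A)\<^sup>2 * exp (W\<^sup>2 - t\<^sup>2 / 4) < 1) at_top"
    by (intro eventually_conj order_tendstoD(2)[of _ 0]) auto
  then obtain t2 where t2: "\<And>t. t \<ge> t2 \<Longrightarrow> (C * (t / 2) powr A)\<^sup>2 * exp (W\<^sup>2 - t\<^sup>2 / 4) < 1"
      "\<And>t. t \<ge> t2 \<Longrightarrow> (C * (3 * t / 2) powr A)\<^sup>2 * exp (W\<^sup>2 - t\<^sup>2 / 4) < 1"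
    unfolding eventually_at_top_linorder by blast
  \<comment> \<open>In turn: the horizontal sides are negligible; \<open>t\<close> is positive and
    \<open>t / 2 > \<tau>\<close>; the growth bound applies from height \<open>t / 2\<close> on; the
    disc lies above \<open>\<tau>\<close> and is at least 1 away from the horizontal sides.\<close>
  define t1 where "t1 = Max {t2, 2 * \<bar>\<tau>\<bar> + 1, 2 * \<bar>t0\<bar>, 2 * (R + 1) + \<bar>\<tau>\<bar>}"
  have t1: "t1 \<ge> t2" "t1 \<ge> 2 * \<bar>\<tau>\<bar> + 1" "t1 \<ge> 2 * \<bar>t0\<bar>" "t1 \<ge> 2 * (R + 1) + \<bar>\<tau>\<bar>"
    unfolding t1_def by (intro Max_ge; simp)+
  \<comment> \<open>\<open>exp (R\<^sup>2)\<close> undoes the Gaussian weight on the disc,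
    \<open>exp (W\<^sup>2)\<close> bounds its horizontal part on the vertical sides, and
    \<open>2 * W\<close> comes from the horizontal sides, where \<open>g\<close> is at most
    1.\<close>
  define K where "K = exp (R\<^sup>2) * (exp (W\<^sup>2) + 2 * W) / (2 * pi * \<delta>)"
  have K: "K > 0" using pos by (auto simp: K_def intro!: divide_pos_pos mult_pos_pos add_pos_pos)
  show ?thesis
  proof (rule exI[of _ K], rule conjI[OF K], rule exI[of _ t1], intro conjI allI impI ballI)
    show "t1 > 0" using t1(2) by linarith
    fix t assume t: "t1 \<le> t"
    show t\<tau>: "t / 2 > \<tau>" using t t1 by linarith
    show "t - R > \<tau>" using t t1(4) pos(1) abs_ge_self[of \<tau>] by argo
    fix s assume s: "s \<in> cball (Complex b t) R"
    have t_pos: "t > 0" using t t1 by linarith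
    define g where "g z = (L z)\<^sup>2 * exp ((z - Complex b t)\<^sup>2)" for z
    define I where "I = integral {t / 2..3 * t / 2} (\<lambda>y. \<phi> y * exp (- (y - t)\<^sup>2))"
    have normg: "norm (g (Complex x y)) = (norm (L (Complex x y)))\<^sup>2 * exp ((x - b)\<^sup>2 - (y - t)\<^sup>2)" for x y
      unfolding g_def norm_mult norm_power norm_exp_square_Complex ..
    have absx: "(x - b)\<^sup>2 \<le> W\<^sup>2" if "\<sigma>' \<le> x" "x \<le> B" for x
      using that pos by (intro abs_le_square_iff[THEN iffD1]) (auto simp: W_def)
    have contL: "continuous_on {t / 2..3 * t / 2} (\<lambda>y. L (Complex x y))" if "x \<ge> \<sigma>'" for x
    proof (rule continuous_on_compose2[OF holomorphic_on_imp_continuous_on[OF holL]])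
      show "continuous_on {t / 2..3 * t / 2} (Complex x)" unfolding Complex_eq by (intro continuous_intros)
      show "Complex x ` {t / 2..3 * t / 2} \<subseteq> {s. Re s > \<alpha> \<and> Im s > \<tau>}"
        using that \<sigma>(1) t\<tau> by auto
    qed
    have cont\<phi>: "continuous_on {t / 2..3 * t / 2} \<phi>"
      unfolding \<phi>_def using pos by (intro continuous_intros contL) (auto simp: R_def)
    have horiz: "norm (g (Complex x y)) \<le> 1"
      if x: "\<sigma>' \<le> x" "x \<le> B" and y: "y = t / 2 \<or> y = 3 * t / 2" for x y
    proof -
      have "\<bar>y - t\<bar> = t / 2" using y t_pos by auto
      then have "\<bar>y - t\<bar>\<^sup>2 = (t / 2)\<^sup>2" by (simp only:)
      then have y': "(y - t)\<^sup>2 = t\<^sup>2 / 4" "y \<ge> 0" "\<bar>y\<bar> \<ge> t0"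
        using y t t1 t_pos by (auto simp: power_divide)
      have "norm (g (Complex x y)) \<le> (C * y powr A)\<^sup>2 * exp (W\<^sup>2 - t\<^sup>2 / 4)"
        unfolding normg using growth[of "Complex x y"] x y' absx[OF x]
        by (intro mult_mono power_mono) auto
      also have "\<dots> \<le> 1" using y t2[OF order_trans[OF t1(1) t]] less_imp_le by metis
      finally show ?thesis .
    qed
    have box: "\<bar>Re s - b\<bar> \<le> R" "\<bar>Im s - t\<bar> \<le> R"
      using s abs_Re_le_cmod[of "Complex b t - s"] abs_Im_le_cmod[of "Complex b t - s"]
      by (auto simp: dist_norm abs_minus_commute)
    have "2 * pi * \<delta> * norm (g s) \<le> integral {t / 2..3 * t / 2}
        (\<lambda>y. norm (g (Complex \<sigma>' y)) + norm (g (Complex B y))) + 2 * (B - \<sigma>') * 1"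
    proof (rule cauchy_rectangle_bound)
      have eq: "{s. Re s > \<alpha> \<and> Im s > \<tau>} = {s. Re s > \<alpha>} \<inter> {s. Im s > \<tau>}" by auto
      show "g holomorphic_on {s. Re s > \<alpha> \<and> Im s > \<tau>}"
        unfolding g_def by (intro holomorphic_intros holL)
      show "convex {s. Re s > \<alpha> \<and> Im s > \<tau>}"
        unfolding eq by (intro convex_Int convex_halfspace_Re_gt convex_halfspace_Im_gt)
      show "open {s. Re s > \<alpha> \<and> Im s > \<tau>}"
        unfolding eq by (intro open_Int open_halfspace_Re_gt open_halfspace_Im_gt)
      show "cbox (Complex \<sigma>' (t / 2)) (Complex B (3 * t / 2)) \<subseteq> {s. Re s > \<alpha> \<and> Im s > \<tau>}"
        using \<sigma>(1) t\<tau> by (auto simp: in_cbox_complex_iff)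
      have "\<delta> \<le> 1" "R + 1 \<le> t / 2" using \<sigma>(4) t t1(4) abs_ge_zero[of \<tau>] unfolding \<delta>_def by argo+
      then show "\<delta> \<le> Im s - t / 2" "\<delta> \<le> 3 * t / 2 - Im s"
        using box(2) unfolding abs_le_iff by argo+
    qed (use pos box \<sigma>(4) horiz in \<open>auto simp: \<delta>_def R_def B_def\<close>)
    also have "integral {t / 2..3 * t / 2} (\<lambda>y. norm (g (Complex \<sigma>' y)) + norm (g (Complex B y)))
      \<le> integral {t / 2..3 * t / 2} (\<lambda>y. exp (W\<^sup>2) * (\<phi> y * exp (- (y - t)\<^sup>2)))"
    proof (rule integral_le)
      show "(\<lambda>y. norm (g (Complex \<sigma>' y)) + norm (g (Complex B y))) integrable_on {t / 2..3 * t / 2}"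
        unfolding normg using pos
        by (intro integrable_continuous_real continuous_intros contL) auto
      show "(\<lambda>y. exp (W\<^sup>2) * (\<phi> y * exp (- (y - t)\<^sup>2))) integrable_on {t / 2..3 * t / 2}"
        by (intro integrable_continuous_real continuous_intros cont\<phi>)
      fix y
      have *: "norm (g (Complex x y)) \<le> exp (W\<^sup>2) * ((norm (L (Complex x y)))\<^sup>2 * exp (- (y - t)\<^sup>2))"
        if "\<sigma>' \<le> x" "x \<le> B" for x
      proof -
        have "norm (g (Complex x y)) \<le> (norm (L (Complex x y)))\<^sup>2 * exp (W\<^sup>2 - (y - t)\<^sup>2)"
          unfolding normg using absx[OF that] by (intro mult_left_mono) auto
        also have "exp (W\<^sup>2 - (y - t)\<^sup>2) = exp (W\<^sup>2) * exp (- (y - t)\<^sup>2)" by (simp flip: exp_add)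
        finally show ?thesis by (simp add: mult_ac)
      qed
      show "norm (g (Complex \<sigma>' y)) + norm (g (Complex B y)) \<le> exp (W\<^sup>2) * (\<phi> y * exp (- (y - t)\<^sup>2))"
        using *[of \<sigma>'] *[of B] pos by (simp add: \<phi>_def B_def algebra_simps)
    qed
    also have "\<dots> = exp (W\<^sup>2) * I" unfolding I_def by simp
    also have "2 * (B - \<sigma>') * 1 = 2 * W" by (simp add: W_def)
    finally have main: "2 * pi * \<delta> * norm (g s) \<le> exp (W\<^sup>2) * I + 2 * W" by simp
    have I: "I \<ge> 0" unfolding I_def \<phi>_def
      by (rule integral_nonneg[OF integrable_continuous_real]) (use cont\<phi> in \<open>auto simp: \<phi>_def intro!: continuous_intros\<close>)
    have "(norm (L s))\<^sup>2 * exp (- R\<^sup>2) \<le> norm (g s)"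
    proof -
      have "(norm (s - Complex b t))\<^sup>2 \<le> R\<^sup>2" using s by (intro power_mono) (auto simp: dist_norm norm_minus_commute)
      then have "- R\<^sup>2 \<le> Re ((s - Complex b t)\<^sup>2)"
        using complex_Re_le_cmod[of "- ((s - Complex b t)\<^sup>2)"] by (simp add: norm_power)
      then show ?thesis by (simp add: g_def norm_mult norm_power mult_left_mono)
    qed
    then have "2 * pi * \<delta> * ((norm (L s))\<^sup>2 * exp (- R\<^sup>2)) \<le> 2 * pi * \<delta> * norm (g s)"
      using pos by (intro mult_left_mono) auto
    also have "\<dots> \<le> (exp (W\<^sup>2) + 2 * W) * (1 + I)"
    proof -
      have "0 \<le> 2 * W * I" "0 \<le> exp (W\<^sup>2)" using pos I by auto
      moreover have "(exp (W\<^sup>2) + 2 * W) * (1 + I) = exp (W\<^sup>2) * I + 2 * W + 2 * W * I + exp (W\<^sup>2)"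
        by (simp add: algebra_simps)
      ultimately show ?thesis using main by linarith
    qed
    finally have "(norm (L s))\<^sup>2 \<le> K * (1 + I)"
      using pos by (simp add: K_def exp_minus field_simps)
    then show "(norm (L s))\<^sup>2 \<le> K * (1 + integral {t / 2..3 * t / 2} (\<lambda>y. \<phi> y * exp (- (y - t)\<^sup>2)))"
      unfolding I_def .
  qed
qed

text \<open>Taking logarithms and using \<open>ln (1 + S) \<le> S\<close> makes the count linear in
  \<open>S\<close>, so that bounds for many discs can be added.\<close>

lemma log_zero_count_bound:
  fixes \<kappa> C S q :: real
  assumes "\<kappa> > 0" "C > 0" "S \<ge> 0" "q > 1" and le: "\<kappa> * q ^ N \<le> C * (1 + S) ^ m"
  shows "real N \<le> (\<bar>ln (C / \<kappa>)\<bar> + real m * S) / ln q"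
proof -
  have "ln \<kappa> + real N * ln q = ln (\<kappa> * q ^ N)"
    using assms by (simp add: ln_mult ln_realpow)
  also have "\<dots> \<le> ln (C * (1 + S) ^ m)"
    using assms by (intro ln_mono le) auto
  also have "\<dots> = ln C + real m * ln (1 + S)"
    using assms by (simp add: ln_mult ln_realpow)
  also have "\<dots> \<le> ln C + real m * S"
    using assms by (intro add_left_mono mult_left_mono ln_add_one_self_le_self) auto
  finally have "real N * ln q \<le> \<bar>ln (C / \<kappa>)\<bar> + real m * S"
    using assms by (simp add: ln_div)
  then show ?thesis using assms by (simp add: field_simps)
qed

lemma sum_UN_le:
  fixes f :: "'a \<Rightarrow> nat"
  assumes "finite I" "\<And>i. i \<in> I \<Longrightarrow> finite (A i)"
  shows "sum f (\<Union>i\<in>I. A i) \<le> (\<Sum>i\<in>I. sum f (A i))"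
  using assms
proof (induction I rule: finite_induct)
  case (insert i I)
  have "sum f (A i \<union> (\<Union>i\<in>I. A i)) \<le> sum f (A i) + sum f (\<Union>i\<in>I. A i)"
    using sum.union_inter[of "A i" "\<Union>i\<in>I. A i" f] insert by simp
  also have "\<dots> \<le> sum f (A i) + (\<Sum>i\<in>I. sum f (A i))" using insert by simp
  finally show ?case using insert by simp
qed simp

section \<open>The zeros of a polynomial in L\<close>

theorem theorem2:
  fixes a :: "nat \<Rightarrow> complex" and L :: "complex \<Rightarrow> complex"
    and m :: nat and c :: "nat \<Rightarrow> complex \<Rightarrow> complex" and \<sigma>\<^sub>0 :: real
  assumes series: "\<And>s. Re s > 1 \<Longrightarrow> (\<lambda>n. a (Suc n) * of_nat (Suc n) powr (- s)) sums L s"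
    and mero: "L nicely_meromorphic_on {s. Re s > 1/2}"
    and fin_poles: "finite {s. Re s > 1/2 \<and> is_pole L s}"
    and poles: "\<And>s. Re s > 1/2 \<Longrightarrow> is_pole L s \<Longrightarrow> Re s = 1"
    and order: "finite_order_right_of (1/2) L"
    and mean_square: "\<And>\<sigma>. 1/2 < \<sigma> \<Longrightarrow> \<sigma> < 1 \<Longrightarrow>
      (\<lambda>T. integral {0..T} (\<lambda>t. (norm (L (Complex \<sigma> t)))\<^sup>2)) \<in> O[at_top](\<lambda>T. T)"
    and coeffs: "\<And>k. k \<le> m \<Longrightarrow> c k \<in> D_s"
    and nonzero: "\<exists>s. Re s > 1/2 \<and> \<not> is_pole L s \<and> poly_comp m c L s \<noteq> 0"
    and \<sigma>\<^sub>0: "\<sigma>\<^sub>0 > 1/2"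
  shows "(\<forall>T. finite (zeros_in (poly_comp m c L) \<sigma>\<^sub>0 T)) \<and>
         (\<lambda>T. real (zero_count (poly_comp m c L) \<sigma>\<^sub>0 T)) \<in> O[at_top](\<lambda>T. T)"
proof -

  \<comment> \<open>Analyticity of \<open>L\<close> and \<open>F\<close> away from the poles\<close>
  define F where "F = poly_comp m c L"
  define P where "P = {s. Re s > 1/2 \<and> is_pole L s}"
  define V where "V = {s. Re s > 1/2} - P"
  have L_analytic: "L analytic_on {s}" if "Re s > 1/2" "\<not> is_pole L s" for s
    using nicely_meromorphic_on_imp_analytic_at[OF mero] that by simp
  have openV: "open V" unfolding V_def P_def using fin_poles
    by (intro open_Diff open_halfspace_Re_gt finite_imp_closed)
  have connV: "connected V" unfolding V_def
    by (intro connected_open_delete_finite open_halfspace_Re_gt convex_connected convex_halfspace_Re_gt)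
       (use fin_poles in \<open>auto simp: P_def\<close>)
  have L_hol: "L holomorphic_on V"
    by (rule analytic_imp_holomorphic, subst analytic_on_analytic_at) (auto simp: V_def P_def intro: L_analytic)
  have c_hol: "c k holomorphic_on {s. Re s > 1/2}" if "k \<le> m" for k
    by (rule abs_conv_gen_dirichlet_holomorphic[OF coeffs[OF that]])
  have F_hol: "F holomorphic_on V"
    unfolding F_def poly_comp_def[abs_def]
    by (intro holomorphic_intros L_hol holomorphic_on_subset[OF c_hol]) (auto simp: V_def)
  have F_mero: "F meromorphic_on {s. Re s > 1/2}"
    unfolding F_def poly_comp_def[abs_def]
  proof (intro meromorphic_intros)
    show "L meromorphic_on {s. Re s > 1/2}" using mero by (simp add: nicely_meromorphic_on_def)
    show "c k meromorphic_on {s. Re s > 1/2}" if "k \<in> {..m}" for k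
      using c_hol[of k] that
      by (intro analytic_on_imp_meromorphic_on)
         (simp only: analytic_on_open[OF open_halfspace_Re_gt] atMost_iff)
  qed
  have VI: "s \<in> V" if "Re s > 1" for s using that poles[of s] by (auto simp: V_def P_def)

  \<comment> \<open>Lower bound far to the right and finiteness of the zeros\<close>
  have L_dir: "L \<in> abs_conv_gen_dirichlet 2"
    using sums_dirichlet_imp_abs_conv_gen_dirichlet[of 1 a L] series by simp
  \<comment> \<open>To the right of 2 both \<open>L\<close> and the coefficients are absolutely
    convergent, so the ring operations apply.\<close>
  have F_dir: "F \<in> abs_conv_gen_dirichlet 2"
    unfolding F_def poly_comp_def[abs_def]
    by (intro abs_conv_gen_dirichlet_sum abs_conv_gen_dirichlet_mult abs_conv_gen_dirichlet_power L_dir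
         subsetD[OF abs_conv_gen_dirichlet_mono coeffs]) auto
  \<comment> \<open>Otherwise the identity theorem on \<open>V\<close>, connected as a half-plane
    without finitely many points, would contradict \<open>nonzero\<close>.\<close>
  have "\<not> (\<forall>s. Re s > 2 \<longrightarrow> F s = 0)"
  proof
    assume zero: "\<forall>s. Re s > 2 \<longrightarrow> F s = 0"
    obtain s where s: "Re s > 1/2" "\<not> is_pole L s" "F s \<noteq> 0" using nonzero unfolding F_def by blast
    have "F s = 0"
    proof (rule analytic_continuation_open[of "{s. Re s > 2}" V F "\<lambda>_. 0" s])
      show "{s. Re s > 2} \<noteq> ({} :: complex set)" by (auto intro!: exI[of _ 3])
    qed (use zero s openV connV F_hol VI in \<open>auto simp: open_halfspace_Re_gt V_def P_def\<close>)
    with s show False by simp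
  qed
  then obtain \<kappa> \<nu> \<sigma>\<^sub>2 where \<kappa>: "\<kappa> > 0" and lower0: "\<And>s. Re s \<ge> \<sigma>\<^sub>2 \<Longrightarrow> norm (F s) \<ge> \<kappa> * exp (- (\<nu> * Re s))"
    using gen_dirichlet_zero_or_lower_bound[OF F_dir] by blast

  \<comment> \<open>The centres of the discs lie on this line: the lower bound holds there, it is
    inside the region of absolute convergence, and it is to the right of
    \<open>\<sigma>\<^sub>0\<close>.\<close>
  define b where "b = Max {\<sigma>\<^sub>2, 3, \<sigma>\<^sub>0 + 1}"
  have b: "b \<ge> \<sigma>\<^sub>2" "b \<ge> 3" "b \<ge> \<sigma>\<^sub>0 + 1" unfolding b_def by (intro Max_ge; simp)+
  have zero_left: "Re \<rho> < b" if "isolated_zero F \<rho>" for \<rho>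
  proof (rule ccontr)
    assume "\<not> Re \<rho> < b"
    then have "Re \<rho> \<ge> \<sigma>\<^sub>2" "\<rho> \<in> V" using b by (auto intro: VI)
    then have "F analytic_on {\<rho>}" using F_hol openV by (auto simp: analytic_at)
    then have "F \<rho> = 0" using zero_isolated_zero_analytic that by blast
    moreover have "\<kappa> * exp (- (\<nu> * Re \<rho>)) > 0" using \<kappa> by simp
    ultimately show False using lower0[OF \<open>Re \<rho> \<ge> \<sigma>\<^sub>2\<close>] by simp
  qed
  have fin: "finite (zeros_in F \<sigma>\<^sub>0 T)" for T
  proof (rule finite_subset)
    show "zeros_in F \<sigma>\<^sub>0 T \<subseteq> {z \<in> cbox (Complex \<sigma>\<^sub>0 0) (Complex b T). isolated_zero F z}"
      using zero_left by (force simp: zeros_in_def in_cbox_complex_iff)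
    show "finite {z \<in> cbox (Complex \<sigma>\<^sub>0 0) (Complex b T). isolated_zero F z}"
      using \<sigma>\<^sub>0 by (intro finite_isolated_zeros_meromorphic[OF F_mero]) (auto simp: in_cbox_complex_iff)
  qed

  \<comment> \<open>Geometry of the discs\<close>
  define e where "e = (min \<sigma>\<^sub>0 1 - 1/2) / 3"
  \<comment> \<open>Three equal steps \<open>e\<close> lead from 1/2 to
    \<open>min \<sigma>\<^sub>0 1\<close>: the mean square is taken at \<open>\<sigma>'\<close>, and
    the discs of radius \<open>R\<close> reach \<open>\<sigma>''\<close>.\<close>
  define \<sigma>' \<sigma>'' where "\<sigma>' = 1/2 + e" and "\<sigma>'' = 1/2 + 2 * e"
  have e: "e > 0" "e \<le> 1/6" "1/2 + 3 * e \<le> \<sigma>\<^sub>0" using \<sigma>\<^sub>0 by (auto simp: e_def min_def field_simps)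
  \<comment> \<open>\<open>F\<close> is bounded on discs of radius \<open>R\<close>, zeros are
    counted in those of radius \<open>r\<close>, and \<open>r0\<close> is a horizontal reach
    sufficient for \<open>\<sigma>\<^sub>0\<close>.\<close>
  define R where "R = b - \<sigma>''"
  define r where "r = R - e / 2"
  define r0 where "r0 = R - e"
  \<comment> \<open>By Pythagoras a disc of radius \<open>r\<close> contains all points with
    horizontal offset at most \<open>r0\<close> and vertical offset at most \<open>\<eta>\<close>,
    so centres spaced by \<open>\<eta>\<close> leave no gap.\<close>
  define \<eta> where "\<eta> = sqrt (r\<^sup>2 - r0\<^sup>2)"
  have R: "0 < r0" "r0 < r" "r < R" "0 < r" "b - \<sigma>\<^sub>0 \<le> r0"
    using e b by (auto simp: R_def r_def r0_def \<sigma>''_def)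
  have \<eta>: "\<eta> > 0" "r0\<^sup>2 + \<eta>\<^sup>2 = r\<^sup>2"
  proof -
    have "r0\<^sup>2 < r\<^sup>2" using R by (intro power_strict_mono) auto
    then show "\<eta> > 0" "r0\<^sup>2 + \<eta>\<^sup>2 = r\<^sup>2" by (auto simp: \<eta>_def)
  qed

  \<comment> \<open>Gaussian means of \<open>L\<close> above the poles\<close>
  define \<tau> where "\<tau> = Max (insert 0 (Im ` P))"
  have \<tau>: "Im s \<le> \<tau>" if "s \<in> P" for s
    unfolding \<tau>_def using fin_poles that by (intro Max_ge) (auto simp: P_def)
  \<comment> \<open>A convex region above all poles, on which \<open>L\<close> and \<open>F\<close>
    are holomorphic; the 0 in \<open>\<tau>\<close> covers the case of no poles.\<close>
  define U where "U = {s. Re s > 1/2 \<and> Im s > \<tau>}"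
  have UV: "U \<subseteq> V" using \<tau> by (force simp: U_def V_def)
  have U_eq: "U = {s. Re s > 1/2} \<inter> {s. Im s > \<tau>}" by (auto simp: U_def)
  have U: "open U" "connected U" unfolding U_eq
    by (intro open_Int open_halfspace_Re_gt open_halfspace_Im_gt convex_connected convex_Int
        convex_halfspace_Re_gt convex_halfspace_Im_gt)+
  obtain A C t0 where growth: "\<And>s. Re s \<ge> \<sigma>' \<Longrightarrow> \<bar>Im s\<bar> \<ge> t0 \<Longrightarrow> norm (L s) \<le> C * \<bar>Im s\<bar> powr A"
    using order e unfolding finite_order_right_of_def \<sigma>'_def by (metis less_add_same_cancel1)
  define \<phi> where "\<phi> y = (norm (L (Complex \<sigma>' y)))\<^sup>2 + (norm (L (Complex (b + R + 1) y)))\<^sup>2" for y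
  define I where "I t = integral {t / 2..3 * t / 2} (\<lambda>y. \<phi> y * exp (- (y - t)\<^sup>2))" for t
  obtain K t1 where K: "K > 0" and t1: "t1 > 0" "\<And>t. t \<ge> t1 \<Longrightarrow> t / 2 > \<tau>" "\<And>t. t \<ge> t1 \<Longrightarrow> t - R > \<tau>"
    and local: "\<And>t s. t \<ge> t1 \<Longrightarrow> s \<in> cball (Complex b t) R \<Longrightarrow> (norm (L s))\<^sup>2 \<le> K * (1 + I t)"
    using local_square_bound[of L "1/2" \<tau> \<sigma>' \<sigma>'' b t0 C A] holomorphic_on_subset[OF L_hol UV] e b growth
    unfolding U_def \<sigma>'_def \<sigma>''_def R_def I_def \<phi>_def by fastforce

  \<comment> \<open>Poles occur only on \<open>Re s = 1\<close>, so on any other vertical line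
    continuity holds at all heights, also below \<open>\<tau>\<close>.\<close>
  have contL: "continuous_on X (\<lambda>y. L (Complex x y))" if "x > 1/2" "x \<noteq> 1" for x X
  proof (rule continuous_on_compose2[OF holomorphic_on_imp_continuous_on[OF L_hol]])
    show "continuous_on X (Complex x)" unfolding Complex_eq by (intro continuous_intros)
    show "Complex x ` X \<subseteq> V" using that poles by (force simp: V_def P_def)
  qed
  have \<sigma>': "1/2 < \<sigma>'" "\<sigma>' < 1" "b + R + 1 > 2" using e b R by (auto simp: \<sigma>'_def)
  have cont\<phi>: "continuous_on X \<phi>" for X
    unfolding \<phi>_def using \<sigma>' by (intro continuous_intros contL) auto
  have I_nonneg: "I t \<ge> 0" for t
    unfolding I_def
    by (intro integral_nonneg integrable_continuous_real continuous_intros cont\<phi>) (auto simp: \<phi>_def)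
  \<comment> \<open>The line at \<open>\<sigma>'\<close> is covered by the hypothesis; on the line
    at \<open>b + R + 1 > 2\<close> the function \<open>L\<close> is bounded.\<close>
  have "(\<lambda>T. integral {0..T} \<phi>) \<in> O[at_top](\<lambda>T. T)"
  proof -
    obtain M where M: "\<forall>s. b + R + 1 \<le> Re s \<and> Re s \<le> b + R + 1 \<longrightarrow> norm (L s) \<le> M"
      using abs_conv_gen_dirichlet_bounded_strip[OF L_dir \<sigma>'(3)] by blast
    have "(\<lambda>T. integral {0..T} (\<lambda>t. (norm (L (Complex (b + R + 1) t)))\<^sup>2)) \<in> O[at_top](\<lambda>T. T)"
    proof (rule landau_o.big_mono[THEN landau_o.big.trans])
      show "eventually (\<lambda>T. norm (integral {0..T} (\<lambda>t. (norm (L (Complex (b + R + 1) t)))\<^sup>2)) \<le> norm (M\<^sup>2 * T)) at_top"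
        using eventually_ge_at_top[of 0]
      proof eventually_elim
        case (elim T)
        have "norm (integral {0..T} (\<lambda>t. (norm (L (Complex (b + R + 1) t)))\<^sup>2)) \<le> integral {0..T} (\<lambda>_. M\<^sup>2)"
          using M \<sigma>' by (intro integral_norm_bound_integral integrable_continuous_real continuous_intros contL)
            (auto intro!: power_mono)
        then show ?case using elim by (simp add: mult.commute)
      qed
    qed simp
    moreover have "(\<lambda>T. integral {0..T} \<phi>) = (\<lambda>T. integral {0..T} (\<lambda>t. (norm (L (Complex \<sigma>' t)))\<^sup>2)
        + integral {0..T} (\<lambda>t. (norm (L (Complex (b + R + 1) t)))\<^sup>2))"
      unfolding \<phi>_def using \<sigma>'
      by (intro ext integral_add integrable_continuous_real continuous_intros contL) auto
    ultimately show ?thesis using sum_in_bigo(1)[OF mean_square[OF \<sigma>'(1,2)]] by simp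
  qed
  then obtain E where E: "\<And>N. (\<Sum>n<N. I (real n * \<eta>)) \<le> E * (real N + 1)"
    using sum_gaussian_integrals_linear[OF cont\<phi> _ \<eta>(1)] unfolding I_def by (auto simp: \<phi>_def)

  \<comment> \<open>Upper bound for \<open>F\<close> in terms of \<open>L\<close>\<close>
  have "\<exists>C>0. \<forall>s. \<sigma>'' \<le> Re s \<and> Re s \<le> b + R \<longrightarrow> norm (F s) \<le> C * (1 + (norm (L s))\<^sup>2) ^ m"
  proof -
    have "\<forall>k\<in>{..m}. \<exists>M. \<forall>s. \<sigma>'' \<le> Re s \<and> Re s \<le> b + R \<longrightarrow> norm (c k s) \<le> M"
      using abs_conv_gen_dirichlet_bounded_strip[OF coeffs] e by (auto simp: \<sigma>''_def)
    then obtain M where M: "\<And>k s. k \<le> m \<Longrightarrow> \<sigma>'' \<le> Re s \<Longrightarrow> Re s \<le> b + R \<Longrightarrow> norm (c k s) \<le> M k"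
      unfolding bchoice_iff by auto
    have "norm (F s) \<le> (1 + (\<Sum>k\<le>m. \<bar>M k\<bar>)) * (1 + (norm (L s))\<^sup>2) ^ m" if s: "\<sigma>'' \<le> Re s" "Re s \<le> b + R" for s
    proof -
      have "norm (F s) \<le> (\<Sum>k\<le>m. norm (c k s * L s ^ k))"
        unfolding F_def poly_comp_def by (rule norm_sum)
      also have "\<dots> \<le> (\<Sum>k\<le>m. \<bar>M k\<bar> * (1 + (norm (L s))\<^sup>2) ^ m)"
      proof (rule sum_mono)
        fix k assume k: "k \<in> {..m}"
        \<comment> \<open>This treats all powers \<open>k \<le> m\<close> at once and brings in the
          square that the Gaussian means control.\<close>
        have "norm (L s) \<le> 1 + (norm (L s))\<^sup>2"
          using zero_le_power2[of "norm (L s) - 1"] norm_ge_zero[of "L s"]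
          by (simp add: power2_eq_square algebra_simps del: norm_ge_zero)
        then have "norm (L s) ^ k \<le> (1 + (norm (L s))\<^sup>2) ^ k" by (intro power_mono) auto
        also have "\<dots> \<le> (1 + (norm (L s))\<^sup>2) ^ m" using k by (intro power_increasing) auto
        finally have "norm (L s) ^ k \<le> (1 + (norm (L s))\<^sup>2) ^ m" .
        moreover have "norm (c k s) \<le> \<bar>M k\<bar>" using M[of k s] s k by auto
        ultimately show "norm (c k s * L s ^ k) \<le> \<bar>M k\<bar> * (1 + (norm (L s))\<^sup>2) ^ m"
          unfolding norm_mult norm_power by (intro mult_mono) auto
      qed
      also have "\<dots> = (\<Sum>k\<le>m. \<bar>M k\<bar>) * (1 + (norm (L s))\<^sup>2) ^ m" by (simp add: sum_distrib_right)
      also have "\<dots> \<le> (1 + (\<Sum>k\<le>m. \<bar>M k\<bar>)) * (1 + (norm (L s))\<^sup>2) ^ m"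
        by (intro mult_right_mono) auto
      finally show ?thesis .
    qed
    moreover have "1 + (\<Sum>k\<le>m. \<bar>M k\<bar>) > 0" by (simp add: add_pos_nonneg sum_nonneg)
    ultimately show ?thesis by blast
  qed
  then obtain C' where C': "C' > 0" and upper:
    "\<And>s. \<sigma>'' \<le> Re s \<Longrightarrow> Re s \<le> b + R \<Longrightarrow> norm (F s) \<le> C' * (1 + (norm (L s))\<^sup>2) ^ m" by blast

  \<comment> \<open>Zeros in a single disc\<close>
  define \<kappa>' where "\<kappa>' = \<kappa> * exp (- (\<nu> * b))"
  have \<kappa>': "\<kappa>' > 0" using \<kappa> by (simp add: \<kappa>'_def)
  \<comment> \<open>The constant of \<open>log_zero_count_bound\<close> for
    \<open>S = K * (1 + I t)\<close>, with \<open>1 + I t\<close> factored out.\<close>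
  define C2 where "C2 = (\<bar>ln (C' / \<kappa>')\<bar> + real m * K) / ln (R / r)"
  have q: "R / r > 1" using R by simp
  then have lnq: "ln (R / r) > 0" by simp
  have C2: "C2 \<ge> 0" unfolding C2_def using K lnq by (intro divide_nonneg_pos) auto
  have disc: "real (\<Sum>\<rho>\<in>Z. nat (zorder F \<rho>)) \<le> C2 * (1 + I t)"
    if t: "t \<ge> t1" and Z: "finite Z" "Z \<subseteq> cball (Complex b t) r" for t Z
  proof -
    have box: "\<bar>Re s - b\<bar> \<le> R \<and> \<bar>Im s - t\<bar> \<le> R" if "dist (Complex b t) s \<le> R" for s
      using that abs_Re_le_cmod[of "Complex b t - s"] abs_Im_le_cmod[of "Complex b t - s"]
      by (auto simp: dist_norm abs_minus_commute)
    \<comment> \<open>The bound at the centre is independent of \<open>t\<close>, since it involves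
      only the real part \<open>b\<close>.\<close>
    have low: "norm (F (Complex b t)) \<ge> \<kappa>'" using lower0[of "Complex b t"] b by (simp add: \<kappa>'_def)
    have "norm (F (Complex b t)) * (R / r) ^ (\<Sum>\<rho>\<in>Z. nat (zorder F \<rho>)) \<le> C' * (1 + K * (1 + I t)) ^ m"
    proof (rule jensen_zero_bound[OF holomorphic_on_subset[OF F_hol UV] U _ R(4,3) _ _ Z])
      show "cball (Complex b t) R \<subseteq> U"
      proof
        fix s assume "s \<in> cball (Complex b t) R"
        then show "s \<in> U" using box[of s] t1(3)[OF t] e by (auto simp: U_def R_def \<sigma>''_def)
      qed
      show "F (Complex b t) \<noteq> 0" using low \<kappa>' by auto
      fix s assume s: "dist (Complex b t) s = R"
      have "norm (F s) \<le> C' * (1 + (norm (L s))\<^sup>2) ^ m"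
        using box[of s] s by (intro upper) (auto simp: R_def)
      also have "\<dots> \<le> C' * (1 + K * (1 + I t)) ^ m"
        using local[OF t, of s] s C' by (intro mult_left_mono power_mono) auto
      finally show "norm (F s) \<le> C' * (1 + K * (1 + I t)) ^ m" .
    qed
    moreover have "\<kappa>' * (R / r) ^ (\<Sum>\<rho>\<in>Z. nat (zorder F \<rho>)) \<le> norm (F (Complex b t)) * (R / r) ^ (\<Sum>\<rho>\<in>Z. nat (zorder F \<rho>))"
      using low R by (intro mult_right_mono) auto
    ultimately have "\<kappa>' * (R / r) ^ (\<Sum>\<rho>\<in>Z. nat (zorder F \<rho>)) \<le> C' * (1 + K * (1 + I t)) ^ m" by linarith
    then have "real (\<Sum>\<rho>\<in>Z. nat (zorder F \<rho>)) \<le> (\<bar>ln (C' / \<kappa>')\<bar> + real m * (K * (1 + I t))) / ln (R / r)"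
      using K I_nonneg[of t] by (intro log_zero_count_bound \<kappa>' C' q) auto
    also have "\<dots> \<le> C2 * (1 + I t)"
    proof -
      have "\<bar>ln (C' / \<kappa>')\<bar> * 1 \<le> \<bar>ln (C' / \<kappa>')\<bar> * (1 + I t)"
        using I_nonneg[of t] by (intro mult_left_mono) auto
      then have "\<bar>ln (C' / \<kappa>')\<bar> + real m * (K * (1 + I t)) \<le> (\<bar>ln (C' / \<kappa>')\<bar> + real m * K) * (1 + I t)"
        by (simp add: algebra_simps)
      then show ?thesis unfolding C2_def times_divide_eq_left using lnq by (intro divide_right_mono) auto
    qed
    finally show ?thesis .
  qed

  \<comment> \<open>Summation over the discs\<close>
  define n0 where "n0 = nat \<lceil>t1 / \<eta>\<rceil>"
  have n0: "real n * \<eta> \<ge> t1" if "n \<ge> n0" for n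
  proof -
    have "t1 / \<eta> \<le> real n" using that unfolding n0_def by linarith
    then show ?thesis using \<eta> by (simp add: field_simps)
  qed
  \<comment> \<open>Zeros too low for the disc bound, including any at poles of \<open>L\<close>,
    contribute a constant.\<close>
  define c0 where "c0 = real (zero_count F \<sigma>\<^sub>0 (real n0 * \<eta>))"
  have count: "real (zero_count F \<sigma>\<^sub>0 T) \<le> c0 + C2 * (real N + E * (real N + 1))"
    if T: "T \<le> real N * \<eta>" for T N
  proof -
    define ord where "ord \<rho> = nat (zorder F \<rho>)" for \<rho>
    define Z where "Z n = zeros_in F \<sigma>\<^sub>0 T \<inter> cball (Complex b (real n * \<eta>)) r" for n
    have finZ: "finite (Z n)" for n using fin by (simp add: Z_def)
    have cover: "zeros_in F \<sigma>\<^sub>0 T \<subseteq> zeros_in F \<sigma>\<^sub>0 (real n0 * \<eta>) \<union> (\<Union>n\<in>{n0..<N}. Z n)"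
    proof
      fix \<rho> assume \<rho>: "\<rho> \<in> zeros_in F \<sigma>\<^sub>0 T"
      then have \<rho>': "isolated_zero F \<rho>" "Re \<rho> > \<sigma>\<^sub>0" "0 < Im \<rho>" "Im \<rho> < T" "Re \<rho> < b"
        using zero_left by (auto simp: zeros_in_def)
      show "\<rho> \<in> zeros_in F \<sigma>\<^sub>0 (real n0 * \<eta>) \<union> (\<Union>n\<in>{n0..<N}. Z n)"
      proof (cases "Im \<rho> < real n0 * \<eta>")
        case True
        then show ?thesis using \<rho>' by (auto simp: zeros_in_def)
      next
        case False
        \<comment> \<open>The disc is the one whose centre has the largest height
          \<open>n * \<eta>\<close> not above \<open>Im \<rho>\<close>.\<close>
        define n where "n = nat \<lfloor>Im \<rho> / \<eta>\<rfloor>"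
        have "0 \<le> Im \<rho> / \<eta>" using \<rho>' \<eta> by simp
        then have "real n \<le> Im \<rho> / \<eta>" "Im \<rho> / \<eta> < real n + 1" unfolding n_def by linarith+
        then have n: "real n * \<eta> \<le> Im \<rho>" "Im \<rho> < real n * \<eta> + \<eta>" using \<eta> by (auto simp: field_simps)
        have "real n0 \<le> Im \<rho> / \<eta>" using False \<eta> by (simp add: field_simps)
        then have "n0 \<le> n" unfolding n_def by linarith
        moreover have "n < N"
        proof -
          have "real n * \<eta> < real N * \<eta>" using n(1) \<rho>'(4) T by linarith
          then show ?thesis using \<eta>(1) by simp
        qed
        moreover have "\<rho> \<in> cball (Complex b (real n * \<eta>)) r"
        proof -
          have "(b - Re \<rho>)\<^sup>2 \<le> r0\<^sup>2" using \<rho>' R by (intro power_mono) auto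
          moreover have "(Im \<rho> - real n * \<eta>)\<^sup>2 \<le> \<eta>\<^sup>2" using n by (intro power_mono) auto
          ultimately have "(b - Re \<rho>)\<^sup>2 + (real n * \<eta> - Im \<rho>)\<^sup>2 \<le> r\<^sup>2"
            using \<eta>(2) by (simp add: power2_commute)
          then show ?thesis using R by (simp add: dist_norm cmod_def real_le_lsqrt)
        qed
        ultimately show ?thesis using \<rho> by (auto simp: Z_def)
      qed
    qed
    have "zero_count F \<sigma>\<^sub>0 T = sum ord (zeros_in F \<sigma>\<^sub>0 T)" by (simp add: zero_count_def ord_def)
    also have "\<dots> \<le> sum ord (zeros_in F \<sigma>\<^sub>0 (real n0 * \<eta>) \<union> (\<Union>n\<in>{n0..<N}. Z n))"
      using cover fin finZ by (intro sum_mono2) auto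
    also have "\<dots> \<le> sum ord (zeros_in F \<sigma>\<^sub>0 (real n0 * \<eta>)) + sum ord (\<Union>n\<in>{n0..<N}. Z n)"
      using sum.union_inter[of "zeros_in F \<sigma>\<^sub>0 (real n0 * \<eta>)" "\<Union>n\<in>{n0..<N}. Z n" ord] fin finZ by simp
    also have "\<dots> \<le> sum ord (zeros_in F \<sigma>\<^sub>0 (real n0 * \<eta>)) + (\<Sum>n\<in>{n0..<N}. sum ord (Z n))"
      by (intro add_left_mono sum_UN_le finZ) auto
    finally have "zero_count F \<sigma>\<^sub>0 T \<le> sum ord (zeros_in F \<sigma>\<^sub>0 (real n0 * \<eta>)) + (\<Sum>n\<in>{n0..<N}. sum ord (Z n))" .
    then have "real (zero_count F \<sigma>\<^sub>0 T) \<le> real (sum ord (zeros_in F \<sigma>\<^sub>0 (real n0 * \<eta>)) + (\<Sum>n\<in>{n0..<N}. sum ord (Z n)))"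
      by (rule of_nat_mono)
    also have "\<dots> = c0 + (\<Sum>n\<in>{n0..<N}. real (sum ord (Z n)))"
      by (simp add: c0_def zero_count_def ord_def)
    also have "\<dots> \<le> c0 + (\<Sum>n\<in>{n0..<N}. C2 * (1 + I (real n * \<eta>)))"
    proof (intro add_left_mono sum_mono)
      fix n assume "n \<in> {n0..<N}"
      then show "real (sum ord (Z n)) \<le> C2 * (1 + I (real n * \<eta>))"
        unfolding ord_def using n0 by (intro disc finZ) (auto simp: Z_def)
    qed
    \<comment> \<open>The added terms with \<open>n < n0\<close> are nonnegative, and the sum takes
      the form bounded by \<open>E\<close>.\<close>
    also have "\<dots> \<le> c0 + (\<Sum>n<N. C2 * (1 + I (real n * \<eta>)))"
      using C2 I_nonneg by (intro add_left_mono sum_mono2) (auto intro!: mult_nonneg_nonneg add_nonneg_nonneg)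
    also have "\<dots> = c0 + C2 * (real N + (\<Sum>n<N. I (real n * \<eta>)))"
      by (simp add: sum_distrib_left[symmetric] sum.distrib)
    also have "\<dots> \<le> c0 + C2 * (real N + E * (real N + 1))"
      using E[of N] C2 by (intro add_left_mono mult_left_mono) auto
    finally show ?thesis .
  qed
  have "(\<lambda>T. real (zero_count F \<sigma>\<^sub>0 T)) \<in> O[at_top](\<lambda>T. T)"
  proof (rule bigoI)
    show "eventually (\<lambda>T. norm (real (zero_count F \<sigma>\<^sub>0 T)) \<le> (c0 + C2 * ((1 + \<bar>E\<bar>) * (1 / \<eta> + 2))) * norm T) at_top"
      using eventually_ge_at_top[of 1]
    proof eventually_elim
      case (elim T)
      \<comment> \<open>The fewest steps of length \<open>\<eta>\<close> that reach
        \<open>T\<close>; for \<open>T \<ge> 1\<close> this gives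
        \<open>N + 1 \<le> (1 / \<eta> + 2) * T\<close>.\<close>
      define N where "N = nat \<lceil>T / \<eta>\<rceil>"
      have "T / \<eta> \<ge> 0" using elim \<eta> by simp
      then have N: "T / \<eta> \<le> real N" "real N \<le> T / \<eta> + 1" unfolding N_def by linarith+
      have "real N + 1 \<le> (1 / \<eta> + 2) * T" using N elim by (simp add: algebra_simps)
      moreover have "E * (real N + 1) \<le> \<bar>E\<bar> * (real N + 1)" by (intro mult_right_mono) auto
      moreover have "(1 + \<bar>E\<bar>) * (real N + 1) \<le> (1 + \<bar>E\<bar>) * ((1 / \<eta> + 2) * T)"
        using calculation(1) by (intro mult_left_mono) auto
      ultimately have "real N + E * (real N + 1) \<le> (1 + \<bar>E\<bar>) * ((1 / \<eta> + 2) * T)"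
        by (simp add: algebra_simps)
      then have "C2 * (real N + E * (real N + 1)) \<le> C2 * ((1 + \<bar>E\<bar>) * ((1 / \<eta> + 2) * T))"
        using C2 by (intro mult_left_mono)
      moreover have "c0 * 1 \<le> c0 * T" using elim by (intro mult_left_mono) (auto simp: c0_def)
      moreover have "T \<le> real N * \<eta>" using N(1) \<eta> by (simp add: field_simps)
      ultimately show ?case using count[of T N] elim by (simp add: algebra_simps)
    qed
  qed
  with fin show ?thesis unfolding F_def by blast
qed

end
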